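(* Let $m\ge1$, $n\ge 2$, $p_1,\dots,p_m\in S_n(1)$, $C_1,\dots,C_m\in\mathbb{R}_+^{n\times n}$ not all zero, and weights $w_l\ge0$ with $\sum_{l=1}^m w_l=1$. For given $\varepsilon>0$, run the Dual Iterative Bregman Projection algorithm (described in the context) with $$\gamma:=\frac14\,\frac{\varepsilon}{\ln n},\qquad \varepsilon':=\frac14\,\frac{\varepsilon}{\max_l\|C_l\|_\infty},$$ to obtain matrices $B_1,\dots,B_m$, and set $$q:=\frac{1}{\sum_{l=1}^m w_l\langle\mathbf 1,B_l\mathbf 1\rangle}\sum_{l=1}^m w_lB_l^T\mathbf 1 .$$ Then $q\in S_n(1)$ and $$\sum_{l=1}^m w_l\mathcal W(p_l,q)-\sum_{l=1}^m w_l\mathcal W(p_l,q^* )\le\varepsilon,$$ where $q^*$ is a solution of the non-regularized barycenter problem $\min_{q\in S_n(1)}\sum_{l=1}^m w_l\mathcal W(p_l,q)$. This procedure requires $$O\left(\left(\frac{\max_l\|C_l\|_\infty}{\varepsilon}\right)^2M_{m,n}\ln n+mn\right)$$ arithmetic operations, where $M_{m,n}$ is the time complexity of one iteration of the Dual Iterative Bregman Projection algorithm.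
   Context: $S_n(1)=\{q\in\mathbb{R}_+^n:\sum_i q_i=1\}$; $\mathbf 1$ is the all-ones column vector; $\langle A,B\rangle$ is the sum of products of entries; $\|C\|_\infty$ is the maximal element of the nonnegative matrix $C$. $\Pi(p,q)=\{\pi\in\mathbb{R}_+^{n\times n}:\pi\mathbf 1=p,\ \pi^T\mathbf 1=q\}$, and $\mathcal W(p_l,q)=\min_{\pi\in\Pi(p_l,q)}\langle\pi,C_l\rangle$ (the $l$-th distance uses cost matrix $C_l$). Logarithms and exponentials of vectors and matrices are element-wise, with $\ln0=-\infty$, $e^{-\infty}=0$ when some $p_l$ has zero entries. Let $K_l=\exp(-C_l/\gamma)$ (element-wise) and $B_l(u_l,v_l)=\mathrm{diag}(e^{u_l})K_l\,\mathrm{diag}(e^{v_l})$. Dual Iterative Bregman Projection algorithm with parameters $\gamma,\varepsilon'$: start with $t=0$ and $u_l^0=v_l^0=0\in\mathbb{R}^n$ for $l=1,\dots,m$. Repeat: (i) for all $l$, $v_l^{t+1}:=\sum_{k=1}^m w_k\ln(K_k^Te^{u_k^t})-\ln(K_l^Te^{u_l^t})$ and $u_l^{t+1}:=u_l^t$; then $t:=t+1$; (ii) for all $l$, $u_l^{t+1}:=\ln p_l-\ln(K_le^{v_l^t})$ and $v_l^{t+1}:=v_l^t$; then $t:=t+1$; until $\sum_{l=1}^m w_l\|B_l^T(u_l^t,v_l^t)\mathbf 1-\bar q^t\|_1\le\varepsilon'$, where $\bar q^t:=\sum_{l=1}^m w_lB_l^T(u_l^t,v_l^t)\mathbf 1$.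 Output $B_l=B_l(u_l^t,v_l^t)$, $l=1,\dots,m$. Each half-step counts as one iteration.
   Formalization: The operation bound is proved for ε ≤ a·max‖C_l‖∞, for every fixed a>0, with the O-constant depending only on a; for ε/max‖C_l‖∞→∞ it fails, since two iterations always run. Accuracy and termination hold for all ε>0. *)

theory Defs
  imports Complex_Main "HOL-Library.Extended_Real" "HOL-Library.Monad_Syntax"
begin

text \<open>
  The dimensions \<open>m\<close> and \<open>n\<close> are quantified inside the statement (the constant in the
  complexity bound does not depend on them), so vectors and matrices are functions on \<open>nat\<close>, of
  which only the arguments below the dimension matter. For families such as \<open>p\<close>, \<open>C\<close>, \<open>u\<close>, \<open>v\<close>
  the first argument is the index \<open>l < m\<close>.
\<close>

section \<open>Wasserstein barycenters\<close>

definition prob_simplex :: "nat \<Rightarrow> (nat \<Rightarrow> real) set" where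
  "prob_simplex n = {q. (\<forall>i<n. 0 \<le> q i) \<and> (\<Sum>i<n. q i) = 1}"

definition couplings :: "nat \<Rightarrow> (nat \<Rightarrow> real) \<Rightarrow> (nat \<Rightarrow> real) \<Rightarrow> (nat \<Rightarrow> nat \<Rightarrow> real) set" where
  "couplings n p q = {\<pi>. (\<forall>i<n. \<forall>j<n. 0 \<le> \<pi> i j)
     \<and> (\<forall>i<n. (\<Sum>j<n. \<pi> i j) = p i) \<and> (\<forall>j<n. (\<Sum>i<n. \<pi> i j) = q j)}"

definition mat_inner :: "nat \<Rightarrow> (nat \<Rightarrow> nat \<Rightarrow> real) \<Rightarrow> (nat \<Rightarrow> nat \<Rightarrow> real) \<Rightarrow> real" where
  "mat_inner n A B = (\<Sum>i<n. \<Sum>j<n. A i j * B i j)"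

definition mat_max :: "nat \<Rightarrow> (nat \<Rightarrow> nat \<Rightarrow> real) \<Rightarrow> real" where
  "mat_max n A = Max {A i j | i j. i < n \<and> j < n}"

definition max_cost :: "nat \<Rightarrow> nat \<Rightarrow> (nat \<Rightarrow> nat \<Rightarrow> nat \<Rightarrow> real) \<Rightarrow> real" where
  "max_cost m n C = (MAX l\<in>{..<m}. mat_max n (C l))"

text \<open>
  For \<open>p\<close>, \<open>q\<close> in the simplex the set of couplings is nonempty and compact, so the infimum is the
  minimum.
\<close>

definition wasserstein ::
  "nat \<Rightarrow> (nat \<Rightarrow> nat \<Rightarrow> real) \<Rightarrow> (nat \<Rightarrow> real) \<Rightarrow> (nat \<Rightarrow> real) \<Rightarrow> real" where
  "wasserstein n C p q = (INF \<pi>\<in>couplings n p q. mat_inner n \<pi> C)"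

definition bary_objective ::
  "nat \<Rightarrow> nat \<Rightarrow> (nat \<Rightarrow> real) \<Rightarrow> (nat \<Rightarrow> nat \<Rightarrow> real) \<Rightarrow> (nat \<Rightarrow> nat \<Rightarrow> nat \<Rightarrow> real) \<Rightarrow> (nat \<Rightarrow> real) \<Rightarrow> real"
  where
  "bary_objective m n w p C q = (\<Sum>l<m. w l * wasserstein n (C l) (p l) q)"

definition bary_instance ::
  "nat \<Rightarrow> nat \<Rightarrow> (nat \<Rightarrow> real) \<Rightarrow> (nat \<Rightarrow> nat \<Rightarrow> real) \<Rightarrow> (nat \<Rightarrow> nat \<Rightarrow> nat \<Rightarrow> real) \<Rightarrow> bool" where
  "bary_instance m n w p C \<longleftrightarrow> 1 \<le> m \<and> 2 \<le> n
     \<and> (\<forall>l<m. p l \<in> prob_simplex n)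
     \<and> (\<forall>l<m. \<forall>i<n. \<forall>j<n. 0 \<le> C l i j)
     \<and> (\<exists>l<m. \<exists>i<n. \<exists>j<n. C l i j \<noteq> 0)
     \<and> (\<forall>l<m. 0 \<le> w l) \<and> (\<Sum>l<m. w l) = 1"

section \<open>Dual iterative Bregman projections\<close>

text \<open>
  The scalings \<open>u\<close>, \<open>v\<close> are extended reals because of \<open>ln 0 = -\<infinity>\<close>. Only nonnegative arguments of
  \<open>eln\<close> and arguments below \<open>\<infinity>\<close> of \<open>eexp\<close> occur.
\<close>

definition eln :: "real \<Rightarrow> ereal" where
  "eln x = (if x = 0 then -\<infinity> else ereal (ln x))"

definition eexp :: "ereal \<Rightarrow> real" where
  "eexp x = (if x = -\<infinity> then 0 else exp (real_of_ereal x))"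

definition kernel :: "real \<Rightarrow> (nat \<Rightarrow> nat \<Rightarrow> real) \<Rightarrow> nat \<Rightarrow> nat \<Rightarrow> real" where
  "kernel \<gamma> C i j = exp (- C i j / \<gamma>)"

definition scaled_kernel ::
  "real \<Rightarrow> (nat \<Rightarrow> nat \<Rightarrow> real) \<Rightarrow> (nat \<Rightarrow> ereal) \<Rightarrow> (nat \<Rightarrow> ereal) \<Rightarrow> nat \<Rightarrow> nat \<Rightarrow> real" where
  "scaled_kernel \<gamma> C u v i j = eexp (u i) * kernel \<gamma> C i j * eexp (v j)"

type_synonym scalings = "(nat \<Rightarrow> nat \<Rightarrow> ereal) \<times> (nat \<Rightarrow> nat \<Rightarrow> ereal)"

definition v_step ::
  "nat \<Rightarrow> nat \<Rightarrow> (nat \<Rightarrow> real) \<Rightarrow> (nat \<Rightarrow> nat \<Rightarrow> nat \<Rightarrow> real) \<Rightarrow> real \<Rightarrow> scalings \<Rightarrow> scalings" where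
  "v_step m n w C \<gamma> = (\<lambda>(u, v).
     (u, \<lambda>l j. (\<Sum>k<m. ereal (w k) * eln (\<Sum>i<n. kernel \<gamma> (C k) i j * eexp (u k i)))
               - eln (\<Sum>i<n. kernel \<gamma> (C l) i j * eexp (u l i))))"

definition u_step ::
  "nat \<Rightarrow> (nat \<Rightarrow> nat \<Rightarrow> real) \<Rightarrow> (nat \<Rightarrow> nat \<Rightarrow> nat \<Rightarrow> real) \<Rightarrow> real \<Rightarrow> scalings \<Rightarrow> scalings" where
  "u_step n p C \<gamma> = (\<lambda>(u, v).
     (\<lambda>l i. eln (p l i) - eln (\<Sum>j<n. kernel \<gamma> (C l) i j * eexp (v l j)), v))"

primrec dibp ::
  "nat \<Rightarrow> nat \<Rightarrow> (nat \<Rightarrow> real) \<Rightarrow> (nat \<Rightarrow> nat \<Rightarrow> real) \<Rightarrow> (nat \<Rightarrow> nat \<Rightarrow> nat \<Rightarrow> real) \<Rightarrow> real \<Rightarrow> nat \<Rightarrow> scalings"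
  where
  "dibp m n w p C \<gamma> 0 = ((\<lambda>l i. 0), (\<lambda>l j. 0))"
| "dibp m n w p C \<gamma> (Suc t) =
     (if even t then v_step m n w C \<gamma> (dibp m n w p C \<gamma> t)
      else u_step n p C \<gamma> (dibp m n w p C \<gamma> t))"

definition dibp_mat ::
  "nat \<Rightarrow> nat \<Rightarrow> (nat \<Rightarrow> real) \<Rightarrow> (nat \<Rightarrow> nat \<Rightarrow> real) \<Rightarrow> (nat \<Rightarrow> nat \<Rightarrow> nat \<Rightarrow> real) \<Rightarrow> real \<Rightarrow> nat
    \<Rightarrow> nat \<Rightarrow> nat \<Rightarrow> nat \<Rightarrow> real" where
  "dibp_mat m n w p C \<gamma> t l =
     scaled_kernel \<gamma> (C l) (fst (dibp m n w p C \<gamma> t) l) (snd (dibp m n w p C \<gamma> t) l)"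

definition col_sums :: "nat \<Rightarrow> (nat \<Rightarrow> nat \<Rightarrow> real) \<Rightarrow> nat \<Rightarrow> real" where
  "col_sums n B j = (\<Sum>i<n. B i j)"

definition mean_col_sums ::
  "nat \<Rightarrow> nat \<Rightarrow> (nat \<Rightarrow> real) \<Rightarrow> (nat \<Rightarrow> nat \<Rightarrow> nat \<Rightarrow> real) \<Rightarrow> nat \<Rightarrow> real" where
  "mean_col_sums m n w B j = (\<Sum>l<m. w l * col_sums n (B l) j)"

definition col_residual ::
  "nat \<Rightarrow> nat \<Rightarrow> (nat \<Rightarrow> real) \<Rightarrow> (nat \<Rightarrow> nat \<Rightarrow> nat \<Rightarrow> real) \<Rightarrow> real" where
  "col_residual m n w B =
     (\<Sum>l<m. w l * (\<Sum>j<n. \<bar>col_sums n (B l) j - mean_col_sums m n w B j\<bar>))"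

text \<open>The criterion is tested only at the end of the loop body, that is after an even, positive
  number of half-steps.\<close>

definition dibp_stops ::
  "nat \<Rightarrow> nat \<Rightarrow> (nat \<Rightarrow> real) \<Rightarrow> (nat \<Rightarrow> nat \<Rightarrow> real) \<Rightarrow> (nat \<Rightarrow> nat \<Rightarrow> nat \<Rightarrow> real) \<Rightarrow> real \<Rightarrow> real \<Rightarrow> nat \<Rightarrow> bool"
  where
  "dibp_stops m n w p C \<gamma> \<epsilon>' t \<longleftrightarrow>
     0 < t \<and> even t \<and> col_residual m n w (dibp_mat m n w p C \<gamma> t) \<le> \<epsilon>'"

definition dibp_output ::
  "nat \<Rightarrow> nat \<Rightarrow> (nat \<Rightarrow> real) \<Rightarrow> (nat \<Rightarrow> nat \<Rightarrow> real) \<Rightarrow> (nat \<Rightarrow> nat \<Rightarrow> nat \<Rightarrow> real) \<Rightarrow> real \<Rightarrow> real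
    \<Rightarrow> nat \<Rightarrow> nat \<Rightarrow> nat \<Rightarrow> real" where
  "dibp_output m n w p C \<gamma> \<epsilon>' = dibp_mat m n w p C \<gamma> (LEAST t. dibp_stops m n w p C \<gamma> \<epsilon>' t)"

definition reg_param :: "nat \<Rightarrow> real \<Rightarrow> real" where
  "reg_param n \<epsilon> = 1/4 * (\<epsilon> / ln (real n))"

definition stop_param :: "nat \<Rightarrow> nat \<Rightarrow> (nat \<Rightarrow> nat \<Rightarrow> nat \<Rightarrow> real) \<Rightarrow> real \<Rightarrow> real" where
  "stop_param m n C \<epsilon> = 1/4 * (\<epsilon> / max_cost m n C)"

definition normalized_mean ::
  "nat \<Rightarrow> nat \<Rightarrow> (nat \<Rightarrow> real) \<Rightarrow> (nat \<Rightarrow> nat \<Rightarrow> nat \<Rightarrow> real) \<Rightarrow> nat \<Rightarrow> real" where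
  "normalized_mean m n w B j =
     1 / (\<Sum>l<m. w l * (\<Sum>i<n. \<Sum>j'<n. B l i j')) * (\<Sum>l<m. w l * col_sums n (B l) j)"

definition approx_barycenter ::
  "nat \<Rightarrow> nat \<Rightarrow> (nat \<Rightarrow> real) \<Rightarrow> (nat \<Rightarrow> nat \<Rightarrow> real) \<Rightarrow> (nat \<Rightarrow> nat \<Rightarrow> nat \<Rightarrow> real) \<Rightarrow> real \<Rightarrow> nat \<Rightarrow> real"
  where
  "approx_barycenter m n w p C \<epsilon> =
     normalized_mean m n w (dibp_output m n w p C (reg_param n \<epsilon>) (stop_param m n C \<epsilon>))"

section \<open>Counting arithmetic operations\<close>

text \<open>
  A computation yields its value and the number of arithmetic operations it performs. Each
  application of \<open>+\<close>, \<open>-\<close>, \<open>*\<close>, \<open>/\<close>, absolute value, exponential or logarithm to scalars is wrapped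
  in \<open>tick\<close>; storing and reading entries, and comparisons, are free.
\<close>

type_synonym 'a counted = "'a \<times> nat"

definition ret :: "'a \<Rightarrow> 'a counted" where
  "ret x = (x, 0)"

definition tick :: "'a \<Rightarrow> 'a counted" where
  "tick x = (x, 1)"

definition bind_counted :: "'a counted \<Rightarrow> ('a \<Rightarrow> 'b counted) \<Rightarrow> 'b counted" where
  "bind_counted c f = (fst (f (fst c)), snd c + snd (f (fst c)))"

adhoc_overloading Monad_Syntax.bind \<rightleftharpoons> bind_counted

primrec csum :: "nat \<Rightarrow> (nat \<Rightarrow> 'a::{zero,plus} counted) \<Rightarrow> 'a counted" where
  "csum 0 f = ret 0"
| "csum (Suc k) f = do { s \<leftarrow> csum k f; x \<leftarrow> f k; tick (s + x) }"

primrec cvec :: "nat \<Rightarrow> (nat \<Rightarrow> 'a counted) \<Rightarrow> (nat \<Rightarrow> 'a) counted" where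
  "cvec 0 f = ret (\<lambda>_. undefined)"
| "cvec (Suc k) f = do { g \<leftarrow> cvec k f; x \<leftarrow> f k; ret (g(k := x)) }"

text \<open>
  The products with \<open>K\<^sub>l\<close> and its transpose are left to arbitrary routines \<open>mul l\<close> and \<open>mulT l\<close>
  with their own operation counts (naive, or faster for a structured cost), so that the cost of an
  iteration remains a parameter.
\<close>

type_synonym routine = "nat \<Rightarrow> (nat \<Rightarrow> real) \<Rightarrow> (nat \<Rightarrow> real) counted"

definition kernel_routines ::
  "nat \<Rightarrow> nat \<Rightarrow> (nat \<Rightarrow> nat \<Rightarrow> nat \<Rightarrow> real) \<Rightarrow> real \<Rightarrow> routine \<Rightarrow> routine \<Rightarrow> bool" where
  "kernel_routines m n C \<gamma> mul mulT \<longleftrightarrow>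
     (\<forall>l<m. \<forall>x. (\<forall>i<n. fst (mul l x) i = (\<Sum>j<n. kernel \<gamma> (C l) i j * x j))
               \<and> (\<forall>j<n. fst (mulT l x) j = (\<Sum>i<n. kernel \<gamma> (C l) i j * x i)))"

definition v_iter :: "nat \<Rightarrow> nat \<Rightarrow> (nat \<Rightarrow> real) \<Rightarrow> routine \<Rightarrow> scalings \<Rightarrow> scalings counted" where
  "v_iter m n w mulT = (\<lambda>(u, v). do {
     y \<leftarrow> cvec m (\<lambda>l. do {
            e \<leftarrow> cvec n (\<lambda>i. tick (eexp (u l i)));
            z \<leftarrow> mulT l e;
            cvec n (\<lambda>j. tick (eln (z j))) });
     a \<leftarrow> cvec n (\<lambda>j. csum m (\<lambda>k. tick (ereal (w k) * y k j)));
     v' \<leftarrow> cvec m (\<lambda>l. cvec n (\<lambda>j. tick (a j - y l j)));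
     ret (u, v') })"

definition u_iter :: "nat \<Rightarrow> nat \<Rightarrow> (nat \<Rightarrow> nat \<Rightarrow> real) \<Rightarrow> routine \<Rightarrow> scalings \<Rightarrow> scalings counted" where
  "u_iter m n p mul = (\<lambda>(u, v). do {
     u' \<leftarrow> cvec m (\<lambda>l. do {
            e \<leftarrow> cvec n (\<lambda>j. tick (eexp (v l j)));
            z \<leftarrow> mul l e;
            cvec n (\<lambda>i. do {
              a \<leftarrow> tick (eln (p l i));
              b \<leftarrow> tick (eln (z i));
              tick (a - b) }) });
     ret (u', v) })"

text \<open>
  The test evaluates the column sums as \<open>B\<^sub>l\<^sup>T 1 = e\<^bsup>v\<^esup> \<odot> K\<^sub>l\<^sup>T e\<^bsup>u\<^esup>\<close>; they are passed on because
  the final averaging uses them again.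
\<close>

definition residual_test ::
  "nat \<Rightarrow> nat \<Rightarrow> (nat \<Rightarrow> real) \<Rightarrow> routine \<Rightarrow> scalings \<Rightarrow> ((nat \<Rightarrow> nat \<Rightarrow> real) \<times> real) counted" where
  "residual_test m n w mulT = (\<lambda>(u, v). do {
     c \<leftarrow> cvec m (\<lambda>l. do {
            e \<leftarrow> cvec n (\<lambda>i. tick (eexp (u l i)));
            z \<leftarrow> mulT l e;
            cvec n (\<lambda>j. do { f \<leftarrow> tick (eexp (v l j)); tick (f * z j) }) });
     qbar \<leftarrow> cvec n (\<lambda>j. csum m (\<lambda>l. tick (w l * c l j)));
     r \<leftarrow> csum m (\<lambda>l. do {
            d \<leftarrow> csum n (\<lambda>j. do { x \<leftarrow> tick (c l j - qbar j); tick \<bar>x\<bar> });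
            tick (w l * d) });
     ret (c, r) })"

definition loop_body ::
  "nat \<Rightarrow> nat \<Rightarrow> (nat \<Rightarrow> real) \<Rightarrow> (nat \<Rightarrow> nat \<Rightarrow> real) \<Rightarrow> routine \<Rightarrow> routine
    \<Rightarrow> scalings \<Rightarrow> (scalings \<times> (nat \<Rightarrow> nat \<Rightarrow> real) \<times> real) counted" where
  "loop_body m n w p mul mulT s = do {
     s1 \<leftarrow> v_iter m n w mulT s;
     s2 \<leftarrow> u_iter m n p mul s1;
     cr \<leftarrow> residual_test m n w mulT s2;
     ret (s2, cr) }"

inductive repeat_until ::
  "('s \<Rightarrow> ('s \<times> 'c \<times> real) counted) \<Rightarrow> real \<Rightarrow> 's \<Rightarrow> 'c \<Rightarrow> nat \<Rightarrow> bool"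
  for body :: "'s \<Rightarrow> ('s \<times> 'c \<times> real) counted" and \<epsilon>' :: real where
  stop: "body s = ((s', c, r), k) \<Longrightarrow> r \<le> \<epsilon>' \<Longrightarrow> repeat_until body \<epsilon>' s c k"
| again: "body s = ((s', c, r), k) \<Longrightarrow> \<not> r \<le> \<epsilon>' \<Longrightarrow> repeat_until body \<epsilon>' s' c' k'
            \<Longrightarrow> repeat_until body \<epsilon>' s c' (k + k')"

definition averaging ::
  "nat \<Rightarrow> nat \<Rightarrow> (nat \<Rightarrow> real) \<Rightarrow> (nat \<Rightarrow> nat \<Rightarrow> real) \<Rightarrow> (nat \<Rightarrow> real) counted" where
  "averaging m n w c = do {
     s \<leftarrow> csum m (\<lambda>l. do { d \<leftarrow> csum n (\<lambda>j. ret (c l j)); tick (w l * d) });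
     h \<leftarrow> tick (1 / s);
     a \<leftarrow> cvec n (\<lambda>j. csum m (\<lambda>l. tick (w l * c l j)));
     cvec n (\<lambda>j. tick (h * a j)) }"

definition set_params ::
  "nat \<Rightarrow> nat \<Rightarrow> (nat \<Rightarrow> nat \<Rightarrow> nat \<Rightarrow> real) \<Rightarrow> real \<Rightarrow> (real \<times> real) counted" where
  "set_params m n C \<epsilon> = do {
     d \<leftarrow> tick (1 / 4);
     a \<leftarrow> tick (ln (real n));
     b \<leftarrow> tick (\<epsilon> / a);
     \<gamma> \<leftarrow> tick (d * b);
     b' \<leftarrow> tick (\<epsilon> / max_cost m n C);
     \<epsilon>' \<leftarrow> tick (d * b');
     ret (\<gamma>, \<epsilon>') }"

text \<open>
  The whole procedure terminates with result \<open>q\<close> after \<open>k\<close> operations. The routines are given for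
  each value of \<open>\<gamma>\<close>.
\<close>

definition procedure_run ::
  "nat \<Rightarrow> nat \<Rightarrow> (nat \<Rightarrow> real) \<Rightarrow> (nat \<Rightarrow> nat \<Rightarrow> real) \<Rightarrow> (nat \<Rightarrow> nat \<Rightarrow> nat \<Rightarrow> real) \<Rightarrow> real
    \<Rightarrow> (real \<Rightarrow> routine) \<Rightarrow> (real \<Rightarrow> routine) \<Rightarrow> (nat \<Rightarrow> real) \<Rightarrow> nat \<Rightarrow> bool" where
  "procedure_run m n w p C \<epsilon> mul mulT q k \<longleftrightarrow>
     (\<exists>\<gamma> \<epsilon>' c k\<^sub>1 k\<^sub>2 k\<^sub>3. set_params m n C \<epsilon> = ((\<gamma>, \<epsilon>'), k\<^sub>1)
        \<and> repeat_until (loop_body m n w p (mul \<gamma>) (mulT \<gamma>)) \<epsilon>' ((\<lambda>l i. 0), (\<lambda>l j. 0)) c k\<^sub>2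
        \<and> averaging m n w c = (q, k\<^sub>3)
        \<and> k = k\<^sub>1 + k\<^sub>2 + k\<^sub>3)"

text \<open>\<open>M\<close> bounds the number of operations of one iteration, that is of either half-step.\<close>

definition iteration_cost ::
  "nat \<Rightarrow> nat \<Rightarrow> (nat \<Rightarrow> real) \<Rightarrow> (nat \<Rightarrow> nat \<Rightarrow> real) \<Rightarrow> routine \<Rightarrow> routine \<Rightarrow> real \<Rightarrow> bool" where
  "iteration_cost m n w p mul mulT M \<longleftrightarrow>
     (\<forall>s. real (snd (v_iter m n w mulT s)) \<le> M \<and> real (snd (u_iter m n p mul s)) \<le> M)"

end

theory Submission
  imports Defs
begin

text \<open>
  After minimisation over \<open>u\<close> the dual objective becomes, up to a constant, the convex function
  \<open>\<Phi>(v) = \<Sum>\<^sub>l w\<^sub>l \<langle>p\<^sub>l, ln (K\<^sub>l e\<^bsup>v\<^sub>l\<^esup>)\<rangle>\<close>, whose gradient consists of the weighted column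
  marginals \<open>c\<^sub>l\<close> of the current plans. One pass of the loop decreases \<open>\<Phi>\<close> by at least one minus the
  total mass of the geometric mean of the \<open>c\<^sub>l\<close>, hence by a constant times the square of the residual
  \<open>r\<close>. The scalings \<open>v\<^sub>l\<close> sum to zero and oscillate by at most \<open>2 \<parallel>C\<parallel> / \<gamma>\<close>, so convexity bounds the
  gap of \<open>\<Phi>\<close> between two iterates by a multiple of \<open>r \<parallel>C\<parallel> / \<gamma>\<close>. The two estimates together give
  \<open>r \<le> \<epsilon>'\<close> after \<open>O(\<parallel>C\<parallel> / (\<gamma> \<epsilon>'))\<close> passes.

  For the accuracy, the row marginals are exact, so rounding the plan to the common column marginal
  costs at most \<open>\<parallel>C\<parallel> r / 2\<close>; and \<open>C\<^sub>l = \<gamma> (u\<^sub>l + v\<^sub>l - ln B\<^sub>l)\<close> compares the cost of \<open>B\<^sub>l\<close> with that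
  of any coupling up to the entropy \<open>2 \<gamma> ln n\<close> and a pairing of \<open>v\<^sub>l\<close> with the defect of the column
  marginals, which averages to at most \<open>\<parallel>C\<parallel> r\<close>.
\<close>

section \<open>Inequalities and couplings\<close>

text \<open>Jensen for \<open>exp\<close>: the exponential lies above its tangent at the mean
  \<open>a\<close>, and the linear part of the tangent averages to zero.\<close>

lemma exp_weighted_mean_le:
  fixes w y :: "'a \<Rightarrow> real"
  assumes "\<And>k. k \<in> A \<Longrightarrow> 0 \<le> w k" and w1: "sum w A = 1"
  shows "exp (\<Sum>k\<in>A. w k * y k) \<le> (\<Sum>k\<in>A. w k * exp (y k))"
proof -
  define a where "a = (\<Sum>k\<in>A. w k * y k)"
  have "(\<Sum>k\<in>A. w k * (1 + (y k - a))) = 1"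
  proof -
    have "(\<Sum>k\<in>A. w k * (1 + (y k - a))) = sum w A + a - sum w A * a"
      by (simp add: algebra_simps sum.distrib sum_subtractf a_def[symmetric] flip: sum_distrib_left sum_distrib_right)
    then show ?thesis using w1 by simp
  qed
  then have "exp a = exp a * (\<Sum>k\<in>A. w k * (1 + (y k - a)))" by simp
  also have "\<dots> \<le> exp a * (\<Sum>k\<in>A. w k * exp (y k - a))"
    by (intro mult_left_mono sum_mono assms) auto
  also have "\<dots> = (\<Sum>k\<in>A. w k * exp (y k))"
    by (simp add: sum_distrib_left exp_diff)
  finally show ?thesis by (simp add: a_def)
qed

text \<open>The gap between the arithmetic and the geometric mean dominates the variance of the square
  roots, by the inequality between the two means applied to the square roots.\<close>

lemma mean_deviation_le:
  fixes w a :: "'a \<Rightarrow> real"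
  assumes w0: "\<And>k. k \<in> A \<Longrightarrow> 0 \<le> w k" and w1: "sum w A = 1"
    and pos: "\<And>k. k \<in> A \<Longrightarrow> 0 < a k" and tau: "0 < \<tau>"
  defines "b \<equiv> (\<Sum>k\<in>A. w k * a k)"
  shows "(\<Sum>k\<in>A. w k * \<bar>a k - b\<bar>) \<le> (b - exp (\<Sum>k\<in>A. w k * ln (a k))) / \<tau> + 4 * \<tau> * b"
proof -
  define s where "s k = sqrt (a k)" for k
  define g where "g = (\<Sum>k\<in>A. w k * s k)"
  have s2: "(s k)\<^sup>2 = a k" and s0: "0 < s k" if "k \<in> A" for k
    using pos[OF that] by (auto simp: s_def)
  have g0: "0 \<le> g" unfolding g_def
    by (intro sum_nonneg mult_nonneg_nonneg w0) (use s0 in \<open>auto intro: less_imp_le\<close>)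
  have geo: "exp (\<Sum>k\<in>A. w k * ln (a k)) \<le> g\<^sup>2"
  proof -
    have "(\<Sum>k\<in>A. w k * ln (a k)) = 2 * (\<Sum>k\<in>A. w k * ln (s k))"
      unfolding sum_distrib_left by (rule sum.cong) (auto simp: s_def ln_sqrt[OF less_imp_le[OF pos]])
    then have "exp (\<Sum>k\<in>A. w k * ln (a k)) = (exp (\<Sum>k\<in>A. w k * ln (s k)))\<^sup>2"
      by (simp add: exp_double)
    moreover have "exp (\<Sum>k\<in>A. w k * ln (s k)) \<le> g"
    proof -
      have "exp (\<Sum>k\<in>A. w k * ln (s k)) \<le> (\<Sum>k\<in>A. w k * exp (ln (s k)))"
        by (rule exp_weighted_mean_le[OF w0 w1])
      also have "\<dots> = g" unfolding g_def by (rule sum.cong) (use s0 in auto)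
      finally show ?thesis .
    qed
    ultimately show ?thesis by (simp add: power_mono)
  qed
  have var: "(\<Sum>k\<in>A. w k * (s k - g)\<^sup>2) = b - g\<^sup>2"
  proof -
    have "(\<Sum>k\<in>A. w k * (s k - g)\<^sup>2) = (\<Sum>k\<in>A. w k * a k - 2 * g * (w k * s k) + g\<^sup>2 * w k)"
      by (rule sum.cong) (auto simp: s2[symmetric] power2_eq_square algebra_simps)
    also have "\<dots> = b - 2 * g * g + g\<^sup>2 * sum w A"
      by (simp add: sum.distrib sum_subtractf b_def g_def flip: sum_distrib_left)
    finally show ?thesis using w1 by (simp add: power2_eq_square)
  qed
  have gb: "g\<^sup>2 \<le> b"
  proof -
    have "0 \<le> (\<Sum>k\<in>A. w k * (s k - g)\<^sup>2)" by (intro sum_nonneg mult_nonneg_nonneg w0) auto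
    then show ?thesis using var by simp
  qed
  \<comment> \<open>Young's inequality for the two factors of \<open>a k - g\<^sup>2\<close>. The
    weight \<open>\<tau>\<close> stays free so that it can later be chosen once for all
    columns.\<close>
  have pt: "\<bar>a k - g\<^sup>2\<bar> \<le> (s k - g)\<^sup>2 / (2 * \<tau>) + \<tau> * (a k + g\<^sup>2)" if "k \<in> A" for k
  proof -
    have "0 \<le> (\<bar>s k - g\<bar> - \<tau> * (s k + g))\<^sup>2" by simp
    then have "2 * \<tau> * (\<bar>s k - g\<bar> * (s k + g)) \<le> (s k - g)\<^sup>2 + \<tau>\<^sup>2 * (s k + g)\<^sup>2"
      by (simp add: power2_diff power_mult_distrib ac_simps)
    moreover have "(s k + g)\<^sup>2 \<le> 2 * (a k + g\<^sup>2)"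
      using zero_le_power2[of "s k - g"] by (simp add: s2[OF that, symmetric] power2_eq_square algebra_simps)
    then have "\<tau>\<^sup>2 * (s k + g)\<^sup>2 \<le> \<tau>\<^sup>2 * (2 * (a k + g\<^sup>2))" by (intro mult_left_mono) auto
    moreover have "\<bar>a k - g\<^sup>2\<bar> = \<bar>s k - g\<bar> * (s k + g)"
    proof -
      have "a k - g\<^sup>2 = (s k - g) * (s k + g)"
        by (simp add: s2[OF that, symmetric] power2_eq_square algebra_simps)
      then show ?thesis using s0[OF that] g0 by (simp add: abs_mult)
    qed
    ultimately have "2 * \<tau> * \<bar>a k - g\<^sup>2\<bar> \<le> (s k - g)\<^sup>2 + \<tau>\<^sup>2 * (2 * (a k + g\<^sup>2))"
      by simp
    then show ?thesis using tau by (simp add: field_simps power2_eq_square)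
  qed
  have dev: "(\<Sum>k\<in>A. w k * \<bar>a k - g\<^sup>2\<bar>) \<le> (b - g\<^sup>2) / (2 * \<tau>) + \<tau> * (b + g\<^sup>2)"
  proof -
    have "(\<Sum>k\<in>A. w k * \<bar>a k - g\<^sup>2\<bar>)
        \<le> (\<Sum>k\<in>A. w k * ((s k - g)\<^sup>2 / (2 * \<tau>) + \<tau> * (a k + g\<^sup>2)))"
      by (intro sum_mono mult_left_mono pt w0)
    also have "\<dots> = (\<Sum>k\<in>A. w k * (s k - g)\<^sup>2) / (2 * \<tau>) + \<tau> * (b + g\<^sup>2 * sum w A)"
      by (simp add: sum.distrib sum_divide_distrib sum_distrib_left sum_distrib_right algebra_simps b_def)
    finally show ?thesis using var w1 by simp
  qed
  \<comment> \<open>Moving the centre from \<open>g\<^sup>2\<close> to \<open>b\<close> costs no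
    more than the deviation itself, hence the doubled bound below.\<close>
  have mid: "\<bar>g\<^sup>2 - b\<bar> \<le> (\<Sum>k\<in>A. w k * \<bar>a k - g\<^sup>2\<bar>)"
  proof -
    have "b - g\<^sup>2 = (\<Sum>k\<in>A. w k * (a k - g\<^sup>2))"
      using w1 by (simp add: right_diff_distrib sum_subtractf b_def flip: sum_distrib_right)
    also have "\<bar>\<dots>\<bar> \<le> (\<Sum>k\<in>A. \<bar>w k * (a k - g\<^sup>2)\<bar>)" by (rule sum_abs)
    also have "\<dots> = (\<Sum>k\<in>A. w k * \<bar>a k - g\<^sup>2\<bar>)"
      by (rule sum.cong) (use w0 in \<open>auto simp: abs_mult\<close>)
    finally show ?thesis by (simp add: abs_minus_commute)
  qed
  have "(\<Sum>k\<in>A. w k * \<bar>a k - b\<bar>) \<le> (\<Sum>k\<in>A. w k * (\<bar>a k - g\<^sup>2\<bar> + \<bar>g\<^sup>2 - b\<bar>))"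
    by (intro sum_mono mult_left_mono w0) auto
  also have "\<dots> = (\<Sum>k\<in>A. w k * \<bar>a k - g\<^sup>2\<bar>) + \<bar>g\<^sup>2 - b\<bar>"
    using w1 by (simp add: distrib_left sum.distrib flip: sum_distrib_right)
  also have "\<dots> \<le> ((b - g\<^sup>2) / (2 * \<tau>) + \<tau> * (b + g\<^sup>2)) + ((b - g\<^sup>2) / (2 * \<tau>) + \<tau> * (b + g\<^sup>2))"
    by (rule add_mono[OF dev order_trans[OF mid dev]])
  also have "\<dots> = (b - g\<^sup>2) / \<tau> + 2 * \<tau> * b + 2 * \<tau> * g\<^sup>2"
    using tau by (simp add: field_simps)
  also have "\<dots> \<le> (b - g\<^sup>2) / \<tau> + 4 * \<tau> * b"
    using mult_left_mono[OF gb, of "2 * \<tau>"] tau by simp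
  also have "\<dots> \<le> (b - exp (\<Sum>k\<in>A. w k * ln (a k))) / \<tau> + 4 * \<tau> * b"
    using geo tau by (simp add: divide_right_mono)
  finally show ?thesis .
qed

text \<open>A \<open>d\<close> of total zero does not see constants, so \<open>y\<close> may be
  replaced by \<open>y - z\<close>.\<close>

lemma sum_mult_le_of_balanced:
  fixes d y :: "'a \<Rightarrow> real"
  assumes "sum d A = 0" and "\<And>j. j \<in> A \<Longrightarrow> \<bar>y j - z\<bar> \<le> R"
  shows "(\<Sum>j\<in>A. d j * y j) \<le> R * (\<Sum>j\<in>A. \<bar>d j\<bar>)"
proof -
  have "(\<Sum>j\<in>A. d j * y j) = (\<Sum>j\<in>A. d j * (y j - z))"
    using assms(1) by (simp add: algebra_simps sum_subtractf flip: sum_distrib_left)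
  also have "\<dots> \<le> (\<Sum>j\<in>A. \<bar>d j\<bar> * R)"
  proof (rule sum_mono)
    fix j assume "j \<in> A"
    have "d j * (y j - z) \<le> \<bar>d j * (y j - z)\<bar>" by simp
    also have "\<dots> \<le> \<bar>d j\<bar> * R"
      unfolding abs_mult by (intro mult_left_mono assms(2) \<open>j \<in> A\<close>) auto
    finally show "d j * (y j - z) \<le> \<bar>d j\<bar> * R" .
  qed
  finally show ?thesis by (simp add: sum_distrib_left mult.commute)
qed

text \<open>Over the first half of the steps the gap \<open>f k - f (2 * N)\<close> falls below \<open>c * R\<^sup>2 / N\<close>, while
  the second half decreases it by at least \<open>N * e\<^sup>2 / c\<close>.\<close>

lemma descent_steps_bound:
  fixes f r :: "nat \<Rightarrow> real"
  assumes big: "\<And>k. k < 2 * N \<Longrightarrow> e < r k"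
    and descent: "\<And>k. k < 2 * N \<Longrightarrow> (r k)\<^sup>2 \<le> c * (f k - f (Suc k))"
    and gap: "\<And>k. k < 2 * N \<Longrightarrow> f k - f (2 * N) \<le> R * r k"
    and pos: "0 < c" "0 < e" "0 < R"
  shows "real N * e \<le> c * R"
proof (cases "N = 0")
  case True
  then show ?thesis using pos by simp
next
  case False
  define \<delta> where "\<delta> k = f k - f (2 * N)" for k
  define D where "D = c * R\<^sup>2"
  have D: "0 < D" using pos by (simp add: D_def)
  have step: "e\<^sup>2 / c \<le> \<delta> k - \<delta> (Suc k)" if "k < 2 * N" for k
  proof -
    have "e\<^sup>2 \<le> (r k)\<^sup>2" using big[OF that] pos by (intro power_mono) auto
    then have "e\<^sup>2 \<le> c * (f k - f (Suc k))" using descent[OF that] by linarith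
    then show ?thesis using pos by (simp add: \<delta>_def field_simps)
  qed
  have lower: "real k * (e\<^sup>2 / c) \<le> \<delta> (2 * N - k)" if "k \<le> 2 * N" for k
    using that
  proof (induction k)
    case 0
    then show ?case by (simp add: \<delta>_def)
  next
    case (Suc k)
    have "Suc (2 * N - Suc k) = 2 * N - k" using Suc.prems by simp
    then have "real k * (e\<^sup>2 / c) + e\<^sup>2 / c \<le> \<delta> (2 * N - Suc k)"
      using Suc step[of "2 * N - Suc k"] by simp
    then show ?case by (simp add: algebra_simps add_divide_distrib)
  qed
  have nonneg: "0 \<le> \<delta> k" if "k \<le> 2 * N" for k
  proof -
    have "0 \<le> real (2 * N - k) * (e\<^sup>2 / c)" using pos by simp
    also have "\<dots> \<le> \<delta> k" using lower[of "2 * N - k"] that by simp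
    finally show ?thesis .
  qed
  have upper: "real k * \<delta> k \<le> D" if "k \<le> 2 * N" for k
    using that
  proof (induction k)
    case 0
    then show ?case using D by simp
  next
    case (Suc k)
    define y where "y = \<delta> k / D"
    have k: "k < 2 * N" using Suc.prems by simp
    have "(\<delta> k)\<^sup>2 \<le> (R * r k)\<^sup>2"
      using gap[OF k] nonneg[of k] k by (intro power_mono) (auto simp: \<delta>_def)
    also have "\<dots> \<le> R\<^sup>2 * (c * (\<delta> k - \<delta> (Suc k)))"
      unfolding power_mult_distrib using descent[OF k] by (intro mult_left_mono) (auto simp: \<delta>_def)
    finally have "(\<delta> k)\<^sup>2 \<le> D * (\<delta> k - \<delta> (Suc k))" by (simp add: D_def algebra_simps)
    then have next_le: "\<delta> (Suc k) / D \<le> y - y\<^sup>2"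
      using D by (simp add: y_def field_simps power2_eq_square)
    have y0: "0 \<le> y" using nonneg[of k] k D by (simp add: y_def)
    \<comment> \<open>Nonnegativity of the next gap forces \<open>y\<^sup>2 \<le> y\<close>; this
      yields the sign of \<open>1 - y\<close> needed below.\<close>
    have "0 \<le> \<delta> (Suc k) / D" using nonneg[of "Suc k"] k D by simp
    then have "y * y \<le> y * 1" using next_le by (simp add: power2_eq_square)
    then have y1: "y \<le> 1" using y0 by (cases "y = 0") auto
    have ky: "real k * y \<le> 1" using Suc.IH k D by (simp add: y_def field_simps)
    have "real (Suc k) * (\<delta> (Suc k) / D) \<le> real (Suc k) * (y - y\<^sup>2)"
      by (intro mult_left_mono next_le) auto
    \<comment> \<open>With \<open>real k * y \<le> 1\<close> and \<open>y \<le> 1\<close> both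
      subtracted terms are nonnegative, so the decay like \<open>1 / k\<close> survives the
      recursion.\<close>
    also have "\<dots> = 1 - (1 - real k * y) * (1 - y) - y\<^sup>2"
      by (simp add: power2_eq_square algebra_simps)
    also have "\<dots> \<le> 1"
      using mult_nonneg_nonneg[of "1 - real k * y" "1 - y"] ky y1 zero_le_power2[of y] by linarith
    finally show ?case using D by (simp add: field_simps)
  qed
  have "real N * (real N * (e\<^sup>2 / c)) \<le> real N * \<delta> N"
    using lower[of N] by (intro mult_left_mono) auto
  also have "\<dots> \<le> D" using upper[of N] by simp
  finally have "c * (real N * (real N * (e\<^sup>2 / c))) \<le> c * D"
    using pos by (intro mult_left_mono) auto
  then have "(real N * e)\<^sup>2 \<le> (c * R)\<^sup>2"
    using pos by (simp add: D_def power2_eq_square ac_simps)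
  then show ?thesis by (rule power2_le_imp_le) (use pos in auto)
qed

section \<open>Transport cost, rounding to couplings, entropy\<close>

lemma couplings_cost_nonneg:
  assumes "\<pi> \<in> couplings n p q" and "\<And>i j. i < n \<Longrightarrow> j < n \<Longrightarrow> 0 \<le> C i j"
  shows "0 \<le> mat_inner n \<pi> C"
  using assms unfolding mat_inner_def couplings_def by (intro sum_nonneg) auto

lemma wasserstein_le:
  assumes "\<pi> \<in> couplings n p q" and "\<And>i j. i < n \<Longrightarrow> j < n \<Longrightarrow> 0 \<le> C i j"
  shows "wasserstein n C p q \<le> mat_inner n \<pi> C"
  unfolding wasserstein_def using assms
  by (intro cINF_lower bdd_belowI2[where m = 0] couplings_cost_nonneg) auto

text \<open>The product plan is a coupling, so the infimum runs over a nonempty set.\<close>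

lemma wasserstein_ge:
  assumes "p \<in> prob_simplex n" "q \<in> prob_simplex n"
    and "\<And>\<pi>. \<pi> \<in> couplings n p q \<Longrightarrow> b \<le> mat_inner n \<pi> C"
  shows "b \<le> wasserstein n C p q"
proof -
  have "(\<lambda>i j. p i * q j) \<in> couplings n p q"
    using assms(1,2) by (auto simp: couplings_def prob_simplex_def simp flip: sum_distrib_left sum_distrib_right)
  then show ?thesis unfolding wasserstein_def using assms(3) by (intro cINF_greatest) auto
qed

text \<open>Columns are scaled down to the smaller of their two prescribed masses, and the missing mass is
  redistributed by a product plan.\<close>

lemma rounding_to_coupling:
  fixes B C :: "nat \<Rightarrow> nat \<Rightarrow> real"
  assumes B0: "\<And>i j. i < n \<Longrightarrow> j < n \<Longrightarrow> 0 \<le> B i j"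
    and row: "\<And>i. i < n \<Longrightarrow> (\<Sum>j<n. B i j) = p i"
    and cpos: "\<And>j. j < n \<Longrightarrow> 0 < col_sums n B j"
    and q0: "\<And>j. j < n \<Longrightarrow> 0 \<le> q j"
    and mass: "(\<Sum>j<n. q j) = (\<Sum>j<n. col_sums n B j)"
    and C0: "\<And>i j. i < n \<Longrightarrow> j < n \<Longrightarrow> 0 \<le> C i j"
    and CM: "\<And>i j. i < n \<Longrightarrow> j < n \<Longrightarrow> C i j \<le> M"
  shows "\<exists>\<pi>\<in>couplings n p q. mat_inner n \<pi> C \<le> mat_inner n B C + M / 2 * (\<Sum>j<n. \<bar>col_sums n B j - q j\<bar>)"
proof -
  define c where "c = col_sums n B"
  \<comment> \<open>\<open>h j\<close> shrinks column \<open>j\<close> to mass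
    \<open>min (c j) (q j)\<close>. What is then missing is \<open>e\<close> in the rows and
    \<open>d\<close> in the columns, both of total \<open>D\<close>.\<close>
  define h where "h j = min (c j) (q j) / c j" for j
  define e where "e i = p i - (\<Sum>j<n. B i j * h j)" for i
  define d where "d j = q j - min (c j) (q j)" for j
  define D where "D = (\<Sum>j<n. d j)"
  define \<pi> where "\<pi> i j = B i j * h j + e i * d j / D" for i j
  have c0: "0 < c j" if "j < n" for j using cpos that by (simp add: c_def)
  have h: "0 \<le> h j" "h j \<le> 1" "c j * h j = min (c j) (q j)" if "j < n" for j
    using c0[OF that] q0[OF that] by (auto simp: h_def)
  have colh: "(\<Sum>i<n. B i j * h j) = min (c j) (q j)" if "j < n" for j
    using h(3)[OF that] by (simp add: c_def col_sums_def flip: sum_distrib_right)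
  have e0: "0 \<le> e i" if "i < n" for i
  proof -
    have "(\<Sum>j<n. B i j * h j) \<le> (\<Sum>j<n. B i j * 1)"
      by (intro sum_mono mult_left_mono) (use h B0 that in auto)
    then show ?thesis using row[OF that] by (simp add: e_def)
  qed
  have d0: "0 \<le> d j" for j by (simp add: d_def)
  have D0: "0 \<le> D" unfolding D_def by (intro sum_nonneg d0)
  have eD: "(\<Sum>i<n. e i) = D"
  proof -
    have "(\<Sum>i<n. p i) = (\<Sum>i<n. \<Sum>j<n. B i j)" using row by simp
    also have "\<dots> = (\<Sum>j<n. c j)" by (subst sum.swap) (simp add: c_def col_sums_def)
    finally have "(\<Sum>i<n. p i) = (\<Sum>j<n. q j)" using mass by (simp add: c_def)
    moreover have "(\<Sum>i<n. \<Sum>j<n. B i j * h j) = (\<Sum>j<n. min (c j) (q j))"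
      by (subst sum.swap) (use colh in simp)
    ultimately show ?thesis by (simp add: e_def D_def d_def sum_subtractf)
  qed
  \<comment> \<open>If \<open>D = 0\<close>, division by zero makes the correction vanish, which is
    right because nothing is missing then.\<close>
  have zero: "e i = 0" "d i = 0" if "D = 0" "i < n" for i
    using that sum_nonneg_eq_0_iff[of "{..<n}" e] sum_nonneg_eq_0_iff[of "{..<n}" d] e0 d0 eD
    by (simp_all add: D_def)
  \<comment> \<open>Equal total masses make excess and deficit of the columns equal, whence the
    factor one half in the claim.\<close>
  have dist: "(\<Sum>j<n. \<bar>c j - q j\<bar>) = 2 * D"
  proof -
    have "(\<Sum>j<n. \<bar>c j - q j\<bar>) = (\<Sum>j<n. 2 * d j + (c j - q j))"
      by (rule sum.cong) (auto simp: d_def min_def)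
    then show ?thesis using mass by (simp add: sum.distrib sum_subtractf D_def c_def flip: sum_distrib_left)
  qed
  have "\<pi> \<in> couplings n p q" unfolding couplings_def
  proof (intro CollectI conjI allI impI)
    fix i j assume "i < n" "j < n"
    then show "0 \<le> \<pi> i j" using B0 h e0 d0 D0 by (simp add: \<pi>_def)
  next
    fix i assume i: "i < n"
    have "(\<Sum>j<n. \<pi> i j) = (\<Sum>j<n. B i j * h j) + e i * D / D"
      by (simp add: \<pi>_def sum.distrib D_def flip: sum_divide_distrib sum_distrib_left)
    then show "(\<Sum>j<n. \<pi> i j) = p i" using zero(1)[OF _ i] by (cases "D = 0") (auto simp: e_def)
  next
    fix j assume j: "j < n"
    have "(\<Sum>i<n. \<pi> i j) = min (c j) (q j) + D * d j / D"
      unfolding \<pi>_def sum.distrib colh[OF j]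
      by (simp add: eD flip: sum_divide_distrib sum_distrib_right)
    then show "(\<Sum>i<n. \<pi> i j) = q j" using zero(2)[OF _ j] by (cases "D = 0") (auto simp: d_def)
  qed
  moreover have "mat_inner n \<pi> C \<le> mat_inner n B C + M / 2 * (\<Sum>j<n. \<bar>c j - q j\<bar>)"
  proof -
    have "mat_inner n \<pi> C \<le> (\<Sum>i<n. \<Sum>j<n. B i j * C i j + e i * d j / D * M)"
      unfolding mat_inner_def
    proof (intro sum_mono)
      fix i j assume "i \<in> {..<n}" "j \<in> {..<n}"
      then have ij: "i < n" "j < n" by auto
      have "B i j * h j * C i j \<le> B i j * C i j"
        using mult_left_mono[OF h(2)[OF ij(2)], of "B i j * C i j"] B0[OF ij] C0[OF ij]
        by (simp add: ac_simps)
      moreover have "e i * d j / D * C i j \<le> e i * d j / D * M"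
        using CM[OF ij] e0[OF ij(1)] d0 D0 by (intro mult_left_mono) auto
      ultimately show "\<pi> i j * C i j \<le> B i j * C i j + e i * d j / D * M"
        by (simp add: \<pi>_def distrib_right)
    qed
    also have "\<dots> = mat_inner n B C + (\<Sum>i<n. e i) * (\<Sum>j<n. d j) / D * M"
      unfolding sum_product by (simp add: mat_inner_def sum.distrib sum_divide_distrib sum_distrib_right)
    also have "\<dots> = mat_inner n B C + M * D" using eD by (cases "D = 0") (auto simp flip: D_def)
    finally show ?thesis using dist by simp
  qed
  ultimately show ?thesis unfolding c_def by blast
qed

lemma entry_le_max_cost:
  assumes "l < m" "i < n" "j < n"
  shows "C l i j \<le> max_cost m n C"
proof -
  have "{C l i j | i j. i < n \<and> j < n} = (\<lambda>(i, j). C l i j) ` ({..<n} \<times> {..<n})" by auto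
  then have "finite {C l i j | i j. i < n \<and> j < n}" by simp
  then have "C l i j \<le> mat_max n (C l)"
    unfolding mat_max_def using assms by (intro Max_ge) auto
  also have "\<dots> \<le> max_cost m n C" unfolding max_cost_def using assms by (intro Max_ge) auto
  finally show ?thesis .
qed

text \<open>This is \<open>ln t \<le> t - 1\<close> at \<open>t = 1 / (N * b)\<close>. Over
  \<open>N\<close> entries of total mass one the corrections \<open>1 / N - b\<close> cancel and
  leave the entropy bound \<open>ln N\<close>.\<close>

lemma neg_mult_ln_le:
  fixes b :: real
  assumes "0 \<le> b" and "0 < N"
  shows "- (b * ln b) \<le> b * ln N + (1 / N - b)"
proof (cases "b = 0")
  case True
  then show ?thesis using assms by simp
next
  case False
  then have b: "0 < b" using assms by simp
  have "b * ln (1 / (N * b)) \<le> b * (1 / (N * b) - 1)"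
    using b assms by (intro mult_left_mono ln_le_minus_one) auto
  moreover have "ln (1 / (N * b)) = - ln N - ln b" using b assms by (simp add: ln_div ln_mult)
  moreover have "b * (1 / (N * b) - 1) = 1 / N - b" using b by (simp add: right_diff_distrib)
  ultimately show ?thesis by (simp add: right_diff_distrib)
qed

section \<open>The dual potential\<close>

locale barycenter_problem =
  fixes m n :: nat and w :: "nat \<Rightarrow> real" and p :: "nat \<Rightarrow> nat \<Rightarrow> real"
    and C :: "nat \<Rightarrow> nat \<Rightarrow> nat \<Rightarrow> real" and \<gamma> :: real
  assumes inst: "bary_instance m n w p C" and gamma_pos: "0 < \<gamma>"
begin

lemma m_pos: "0 < m" and n_ge_2: "2 \<le> n"
  and p_simplex: "l < m \<Longrightarrow> p l \<in> prob_simplex n"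
  and p_nonneg: "l < m \<Longrightarrow> i < n \<Longrightarrow> 0 \<le> p l i"
  and p_sum: "l < m \<Longrightarrow> (\<Sum>i<n. p l i) = 1"
  and C_nonneg: "l < m \<Longrightarrow> i < n \<Longrightarrow> j < n \<Longrightarrow> 0 \<le> C l i j"
  and w_nonneg: "l < m \<Longrightarrow> 0 \<le> w l" and w_sum: "(\<Sum>l<m. w l) = 1"
  using inst by (auto simp: bary_instance_def prob_simplex_def)

lemma max_cost_pos: "0 < max_cost m n C"
proof -
  obtain l i j where lij: "l < m" "i < n" "j < n" "C l i j \<noteq> 0"
    using inst unfolding bary_instance_def by auto
  then show ?thesis using C_nonneg[of l i j] entry_le_max_cost[of l m i n j C] by linarith
qed

section \<open>Reduced iteration, its potential and its invariants\<close>

definition KT :: "(nat \<Rightarrow> nat \<Rightarrow> real) \<Rightarrow> nat \<Rightarrow> nat \<Rightarrow> real" where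
  "KT x l j = (\<Sum>i<n. kernel \<gamma> (C l) i j * x l i)"

definition KV :: "(nat \<Rightarrow> nat \<Rightarrow> real) \<Rightarrow> nat \<Rightarrow> nat \<Rightarrow> real" where
  "KV v l i = (\<Sum>j<n. kernel \<gamma> (C l) i j * exp (v l j))"

text \<open>In the notation of the algorithm, \<open>x\<close> stands for \<open>e\<^bsup>u\<^esup>\<close>, which may vanish, whereas \<open>v\<close>
  is always finite.\<close>

definition v_update :: "(nat \<Rightarrow> nat \<Rightarrow> real) \<Rightarrow> nat \<Rightarrow> nat \<Rightarrow> real" where
  "v_update x l j = (\<Sum>k<m. w k * ln (KT x k j)) - ln (KT x l j)"

definition x_update :: "(nat \<Rightarrow> nat \<Rightarrow> real) \<Rightarrow> nat \<Rightarrow> nat \<Rightarrow> real" where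
  "x_update v l i = p l i / KV v l i"

definition plan :: "(nat \<Rightarrow> nat \<Rightarrow> real) \<Rightarrow> nat \<Rightarrow> nat \<Rightarrow> nat \<Rightarrow> real" where
  "plan v l i j = x_update v l i * kernel \<gamma> (C l) i j * exp (v l j)"

definition marg :: "(nat \<Rightarrow> nat \<Rightarrow> real) \<Rightarrow> nat \<Rightarrow> nat \<Rightarrow> real" where
  "marg v l = col_sums n (plan v l)"

definition residual :: "(nat \<Rightarrow> nat \<Rightarrow> real) \<Rightarrow> real" where
  "residual v = col_residual m n w (plan v)"

text \<open>Up to an additive constant, the dual objective after minimisation over \<open>u\<close>.\<close>

definition potential :: "(nat \<Rightarrow> nat \<Rightarrow> real) \<Rightarrow> real" where
  "potential v = (\<Sum>l<m. w l * (\<Sum>i<n. p l i * ln (KV v l i)))"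

text \<open>Zeros of \<open>p\<close> produce zeros of \<open>x\<close>; since the kernel is
  strictly positive, some positive mass suffices to keep \<open>KT x\<close> positive.\<close>

definition positive_mass :: "(nat \<Rightarrow> nat \<Rightarrow> real) \<Rightarrow> bool" where
  "positive_mass x \<longleftrightarrow> (\<forall>l<m. (\<forall>i<n. 0 \<le> x l i) \<and> 0 < (\<Sum>i<n. x l i))"

text \<open>The constraint of the dual barycenter problem on the column scalings; it is dual to the
  common column marginal being free.\<close>

definition centered :: "(nat \<Rightarrow> nat \<Rightarrow> real) \<Rightarrow> bool" where
  "centered v \<longleftrightarrow> (\<forall>j<n. (\<Sum>l<m. w l * v l j) = 0)"

text \<open>The centre may depend on \<open>l\<close>: only the oscillation of each
  \<open>v l\<close> is bounded, not its additive constant.\<close>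

definition narrow :: "(nat \<Rightarrow> nat \<Rightarrow> real) \<Rightarrow> bool" where
  "narrow v \<longleftrightarrow> (\<forall>l<m. \<exists>z. \<forall>j<n. \<bar>v l j - z\<bar> \<le> max_cost m n C / \<gamma>)"

lemma kernel_pos: "0 < kernel \<gamma> (C l) i j"
  by (simp add: kernel_def)

lemma KV_pos: "0 < KV v l i"
  unfolding KV_def using n_ge_2 by (intro sum_pos mult_pos_pos kernel_pos) (auto simp: lessThan_empty_iff)

text \<open>Kernel entries lie between \<open>exp (- max_cost m n C / \<gamma>)\<close> and 1, so
  the entries of \<open>KT x l\<close> agree up to this factor.\<close>

lemma KT_bounds:
  assumes "positive_mass x" "l < m" "j < n"
  shows "exp (- max_cost m n C / \<gamma>) * (\<Sum>i<n. x l i) \<le> KT x l j" and "KT x l j \<le> (\<Sum>i<n. x l i)"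
proof -
  have x: "0 \<le> x l i" if "i < n" for i using assms that by (auto simp: positive_mass_def)
  show "exp (- max_cost m n C / \<gamma>) * (\<Sum>i<n. x l i) \<le> KT x l j"
    unfolding KT_def sum_distrib_left kernel_def using x assms gamma_pos
    by (intro sum_mono mult_right_mono) (auto intro!: divide_right_mono entry_le_max_cost)
  have "KT x l j \<le> (\<Sum>i<n. 1 * x l i)"
    unfolding KT_def kernel_def using x assms gamma_pos C_nonneg
    by (intro sum_mono mult_right_mono) auto
  then show "KT x l j \<le> (\<Sum>i<n. x l i)" by simp
qed

lemma KT_pos:
  assumes "positive_mass x" "l < m" "j < n"
  shows "0 < KT x l j"
proof -
  have "0 < exp (- max_cost m n C / \<gamma>) * (\<Sum>i<n. x l i)"
    using assms by (simp add: positive_mass_def)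
  then show ?thesis using KT_bounds(1)[OF assms] by linarith
qed

lemma positive_mass_x_update: "positive_mass (x_update v)"
  unfolding positive_mass_def
proof (intro allI impI conjI)
  fix l i assume "l < m" "i < n"
  then show "0 \<le> x_update v l i" using p_nonneg KV_pos by (simp add: x_update_def less_imp_le)
next
  fix l assume l: "l < m"
  then obtain i where i: "i < n" "p l i \<noteq> 0"
    using p_sum[OF l] by (metis lessThan_iff sum.neutral zero_neq_one)
  show "0 < (\<Sum>i<n. x_update v l i)"
  proof (rule sum_pos2[of _ i])
    show "0 < x_update v l i" using i p_nonneg[OF l i(1)] KV_pos by (simp add: x_update_def)
    fix i assume "i \<in> {..<n}"
    then show "0 \<le> x_update v l i" using p_nonneg l KV_pos by (simp add: x_update_def less_imp_le)
  qed (use i in auto)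
qed

lemma centered_v_update: "centered (v_update x)"
proof -
  have "(\<Sum>l<m. w l * v_update x l j) = (\<Sum>l<m. w l) * (\<Sum>k<m. w k * ln (KT x k j)) - (\<Sum>l<m. w l * ln (KT x l j))" for j
    by (simp add: v_update_def right_diff_distrib sum_subtractf flip: sum_distrib_right)
  then show ?thesis using w_sum by (simp add: centered_def)
qed

lemma narrow_v_update:
  assumes x: "positive_mass x"
  shows "narrow (v_update x)"
  unfolding narrow_def
proof (intro allI impI)
  fix l assume l: "l < m"
  define S where "S k = ln (\<Sum>i<n. x k i)" for k
  define \<rho> where "\<rho> = max_cost m n C / \<gamma>"
  have b: "S k - \<rho> \<le> ln (KT x k j) \<and> ln (KT x k j) \<le> S k" if "k < m" "j < n" for k j
  proof
    have pos: "0 < (\<Sum>i<n. x k i)" using x that by (simp add: positive_mass_def)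
    have "S k - \<rho> = ln (exp (- max_cost m n C / \<gamma>) * (\<Sum>i<n. x k i))"
      using pos by (simp add: S_def \<rho>_def ln_mult)
    also have "\<dots> \<le> ln (KT x k j)"
      using KT_bounds(1)[OF x that] pos KT_pos[OF x that] by (subst ln_le_cancel_iff) auto
    finally show "S k - \<rho> \<le> ln (KT x k j)" .
    show "ln (KT x k j) \<le> S k"
      unfolding S_def using KT_bounds(2)[OF x that] pos KT_pos[OF x that]
      by (subst ln_le_cancel_iff) auto
  qed
  show "\<exists>z. \<forall>j<n. \<bar>v_update x l j - z\<bar> \<le> max_cost m n C / \<gamma>"
  \<comment> \<open>The centre is the update with every logarithm replaced by its upper bound. Both
    resulting errors lie between \<open>- \<rho>\<close> and 0, so their difference is at most
    \<open>\<rho>\<close> in absolute value.\<close>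
  proof (intro exI[of _ "(\<Sum>k<m. w k * S k) - S l"] allI impI)
    fix j assume j: "j < n"
    have "(\<Sum>k<m. w k * (S k - \<rho>)) \<le> (\<Sum>k<m. w k * ln (KT x k j))"
      by (intro sum_mono mult_left_mono) (use b j w_nonneg in auto)
    moreover have "(\<Sum>k<m. w k * (S k - \<rho>)) = (\<Sum>k<m. w k * S k) - \<rho>"
      using w_sum by (simp add: right_diff_distrib sum_subtractf flip: sum_distrib_right)
    moreover have "(\<Sum>k<m. w k * ln (KT x k j)) \<le> (\<Sum>k<m. w k * S k)"
      by (intro sum_mono mult_left_mono) (use b j w_nonneg in auto)
    ultimately show "\<bar>v_update x l j - ((\<Sum>k<m. w k * S k) - S l)\<bar> \<le> max_cost m n C / \<gamma>"
      using b[OF l j] unfolding v_update_def \<rho>_def[symmetric] by linarith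
  qed
qed

section \<open>Marginals of the plans and the residual\<close>

lemma plan_nonneg: "l < m \<Longrightarrow> i < n \<Longrightarrow> 0 \<le> plan v l i j"
  using positive_mass_x_update[of v] kernel_pos by (simp add: plan_def positive_mass_def less_imp_le)

lemma plan_row_sum: "(\<Sum>j<n. plan v l i j) = p l i"
proof -
  have "(\<Sum>j<n. plan v l i j) = x_update v l i * KV v l i"
    by (simp add: plan_def KV_def sum_distrib_left mult.assoc)
  then show ?thesis using KV_pos[of v l i] by (simp add: x_update_def)
qed

lemma marg_eq: "marg v l j = exp (v l j) * KT (x_update v) l j"
  by (simp add: marg_def col_sums_def plan_def KT_def sum_distrib_left ac_simps)

lemma marg_pos: "l < m \<Longrightarrow> j < n \<Longrightarrow> 0 < marg v l j"
  using KT_pos[OF positive_mass_x_update] by (simp add: marg_eq)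

lemma marg_sum: "l < m \<Longrightarrow> (\<Sum>j<n. marg v l j) = 1"
  unfolding marg_def col_sums_def by (subst sum.swap) (simp add: plan_row_sum p_sum)

lemma mean_col_sums_plan: "mean_col_sums m n w (plan v) j = (\<Sum>l<m. w l * marg v l j)"
  by (simp add: mean_col_sums_def marg_def)

lemma mean_marg_sum: "(\<Sum>j<n. \<Sum>l<m. w l * marg v l j) = 1"
  by (subst sum.swap) (simp add: marg_sum w_sum flip: sum_distrib_left)

lemma mean_marg_simplex: "mean_col_sums m n w (plan v) \<in> prob_simplex n"
  unfolding prob_simplex_def mean_col_sums_plan
  using w_nonneg marg_pos by (auto simp: mean_marg_sum less_imp_le intro!: sum_nonneg mult_nonneg_nonneg)

lemma residual_eq:
  "residual v = (\<Sum>l<m. w l * (\<Sum>j<n. \<bar>marg v l j - (\<Sum>k<m. w k * marg v k j)\<bar>))"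
  by (simp add: residual_def col_residual_def mean_col_sums_plan marg_def)

lemma residual_nonneg: "0 \<le> residual v"
  unfolding residual_eq by (intro sum_nonneg mult_nonneg_nonneg) (auto simp: w_nonneg)

lemma residual_square_le:
  "(residual v)\<^sup>2 \<le> 16 * (1 - (\<Sum>j<n. exp (\<Sum>k<m. w k * ln (marg v k j))))"
proof (cases "residual v = 0")
  \<comment> \<open>The choice of \<open>\<tau>\<close> below would be zero here; the claim reduces
    to the inequality between geometric and arithmetic mean.\<close>
  case True
  have "(\<Sum>j<n. exp (\<Sum>k<m. w k * ln (marg v k j))) \<le> (\<Sum>j<n. \<Sum>k<m. w k * marg v k j)"
  proof (rule sum_mono)
    fix j assume j: "j \<in> {..<n}"
    have "exp (\<Sum>k<m. w k * ln (marg v k j)) \<le> (\<Sum>k<m. w k * exp (ln (marg v k j)))"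
      by (rule exp_weighted_mean_le) (auto simp: w_nonneg w_sum)
    also have "\<dots> = (\<Sum>k<m. w k * marg v k j)" using marg_pos j by (intro sum.cong) auto
    finally show "exp (\<Sum>k<m. w k * ln (marg v k j)) \<le> (\<Sum>k<m. w k * marg v k j)" .
  qed
  then show ?thesis using True mean_marg_sum by simp
next
  case False
  \<comment> \<open>Chosen so that \<open>4 * \<tau>\<close> uses up half of the residual
    \<open>8 * \<tau>\<close>; the other half, times \<open>\<tau>\<close>, is one sixteenth of its
    square.\<close>
  define \<tau> where "\<tau> = residual v / 8"
  have tau: "0 < \<tau>" using False residual_nonneg[of v] by (simp add: \<tau>_def)
  define b where "b j = (\<Sum>k<m. w k * marg v k j)" for j
  define g where "g j = exp (\<Sum>k<m. w k * ln (marg v k j))" for j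
  have "residual v = (\<Sum>j<n. \<Sum>l<m. w l * \<bar>marg v l j - b j\<bar>)"
    unfolding residual_eq sum_distrib_left b_def by (rule sum.swap)
  also have "\<dots> \<le> (\<Sum>j<n. (b j - g j) / \<tau> + 4 * \<tau> * b j)"
    unfolding b_def g_def
    by (intro sum_mono mean_deviation_le) (auto simp: w_nonneg w_sum marg_pos tau)
  also have "\<dots> = ((\<Sum>j<n. b j) - (\<Sum>j<n. g j)) / \<tau> + 4 * \<tau> * (\<Sum>j<n. b j)"
    by (simp add: sum.distrib sum_subtractf flip: sum_divide_distrib sum_distrib_left)
  also have "\<dots> = (1 - (\<Sum>j<n. g j)) / \<tau> + 4 * \<tau>" by (simp add: b_def mean_marg_sum)
  finally have "8 * \<tau> \<le> (1 - (\<Sum>j<n. g j)) / \<tau> + 4 * \<tau>" by (simp only: \<tau>_def)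
  then have "4 * \<tau> \<le> (1 - (\<Sum>j<n. g j)) / \<tau>" by linarith
  then have "4 * \<tau> * \<tau> \<le> 1 - (\<Sum>j<n. g j)" using tau by (simp add: field_simps)
  then show ?thesis by (simp add: \<tau>_def g_def power2_eq_square)
qed

section \<open>Decrease and convexity of the potential\<close>

text \<open>By \<open>ln t \<le> t - 1\<close>, the change of \<open>potential\<close> is at most
  the mass obtained from the old row scaling \<open>x\<close> and the new \<open>v'\<close>, minus
  the unit mass of the old plan.\<close>

lemma potential_descent:
  assumes "centered v"
  shows "(residual v)\<^sup>2 \<le> 16 * (potential v - potential (v_update (x_update v)))"
proof -
  define x where "x = x_update v"
  define v' where "v' = v_update x"
  have x: "positive_mass x" unfolding x_def by (rule positive_mass_x_update)
  \<comment> \<open>Centering removes the \<open>v k j\<close> from the logarithms of the marginals.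
    The column sums after the update are thus the geometric mean of the old ones, the same for every
    \<open>l\<close>.\<close>
  have geo: "exp (v' l j) * KT x l j = exp (\<Sum>k<m. w k * ln (marg v k j))" if "l < m" "j < n" for l j
  proof -
    have "ln (marg v k j) = v k j + ln (KT x k j)" if "k < m" for k
      using KT_pos[OF x that \<open>j < n\<close>] by (simp add: marg_eq ln_mult x_def)
    then have "(\<Sum>k<m. w k * ln (marg v k j)) = (\<Sum>k<m. w k * v k j + w k * ln (KT x k j))"
      by (intro sum.cong) (auto simp: distrib_left)
    also have "\<dots> = (\<Sum>k<m. w k * ln (KT x k j))"
      using assms that by (simp add: sum.distrib centered_def)
    finally show ?thesis
      using KT_pos[OF x that] by (simp add: v'_def v_update_def exp_diff)
  qed
  have mass: "(\<Sum>i<n. x l i * KV v' l i) = (\<Sum>j<n. exp (\<Sum>k<m. w k * ln (marg v k j)))" if "l < m" for l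
  proof -
    have "(\<Sum>i<n. x l i * KV v' l i) = (\<Sum>j<n. exp (v' l j) * KT x l j)"
      unfolding KV_def KT_def sum_distrib_left
      by (subst sum.swap) (simp add: ac_simps)
    then show ?thesis using geo that by simp
  qed
  have "potential v' - potential v = (\<Sum>l<m. w l * (\<Sum>i<n. p l i * (ln (KV v' l i) - ln (KV v l i))))"
    by (simp add: potential_def right_diff_distrib sum_subtractf)
  also have "\<dots> \<le> (\<Sum>l<m. w l * (\<Sum>i<n. p l i * (KV v' l i / KV v l i - 1)))"
  proof (intro sum_mono mult_left_mono)
    fix l i
    have "ln (KV v' l i) - ln (KV v l i) = ln (KV v' l i / KV v l i)"
      using KV_pos[of v l i] KV_pos[of v' l i] by (simp add: ln_div)
    also have "\<dots> \<le> KV v' l i / KV v l i - 1" using KV_pos by (intro ln_le_minus_one) auto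
    finally show "ln (KV v' l i) - ln (KV v l i) \<le> KV v' l i / KV v l i - 1" .
  qed (auto simp: w_nonneg p_nonneg)
  also have "\<dots> = (\<Sum>l<m. w l * ((\<Sum>i<n. x l i * KV v' l i) - 1))"
    by (intro sum.cong refl) (simp add: x_def x_update_def right_diff_distrib sum_subtractf p_sum)
  also have "\<dots> = (\<Sum>l<m. w l * ((\<Sum>j<n. exp (\<Sum>k<m. w k * ln (marg v k j))) - 1))"
    by (intro sum.cong refl) (simp add: mass)
  also have "\<dots> = (\<Sum>j<n. exp (\<Sum>k<m. w k * ln (marg v k j))) - 1"
    by (simp add: w_sum flip: sum_distrib_right)
  finally show ?thesis using residual_square_le[of v] by (simp add: v'_def x_def)
qed

text \<open>The gradient inequality for log-sum-exp; the marginals \<open>marg v\<close>, weighted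
  by \<open>w\<close>, form the gradient of \<open>potential\<close> at \<open>v\<close>.\<close>

lemma potential_convex:
  "potential v - potential v' \<le> (\<Sum>l<m. w l * (\<Sum>j<n. marg v l j * (v l j - v' l j)))"
proof -
  have jensen: "p l i * (ln (KV v l i) - ln (KV v' l i)) \<le> (\<Sum>j<n. plan v l i j * (v l j - v' l j))"
    if "l < m" "i < n" for l i
  proof -
    \<comment> \<open>Gibbs weights of row \<open>i\<close>; multiplied by \<open>p l i\<close> they
      are the entries of \<open>plan v l\<close>.\<close>
    define \<theta> where "\<theta> j = kernel \<gamma> (C l) i j * exp (v l j) / KV v l i" for j
    have th: "0 \<le> \<theta> j" for j using kernel_pos KV_pos by (simp add: \<theta>_def less_imp_le)
    have th1: "(\<Sum>j<n. \<theta> j) = 1"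
      using KV_pos[of v l i] by (simp add: \<theta>_def KV_def flip: sum_divide_distrib)
    have "exp (\<Sum>j<n. \<theta> j * (v' l j - v l j)) \<le> (\<Sum>j<n. \<theta> j * exp (v' l j - v l j))"
      by (rule exp_weighted_mean_le) (auto simp: th th1)
    also have "\<dots> = KV v' l i / KV v l i"
      by (simp add: \<theta>_def KV_def[of v'] exp_diff sum_divide_distrib)
    finally have "(\<Sum>j<n. \<theta> j * (v' l j - v l j)) \<le> ln (KV v' l i / KV v l i)"
      using KV_pos by (subst ln_ge_iff) auto
    then have "ln (KV v l i) - ln (KV v' l i) \<le> (\<Sum>j<n. \<theta> j * (v l j - v' l j))"
      using KV_pos[of v l i] KV_pos[of v' l i] by (simp add: ln_div right_diff_distrib sum_subtractf)
    then have "p l i * (ln (KV v l i) - ln (KV v' l i)) \<le> p l i * (\<Sum>j<n. \<theta> j * (v l j - v' l j))"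
      using p_nonneg that by (intro mult_left_mono) auto
    also have "\<dots> = (\<Sum>j<n. plan v l i j * (v l j - v' l j))"
      by (simp add: sum_distrib_left plan_def x_update_def \<theta>_def mult.assoc)
    finally show ?thesis .
  qed
  have "potential v - potential v' = (\<Sum>l<m. w l * (\<Sum>i<n. p l i * (ln (KV v l i) - ln (KV v' l i))))"
    by (simp add: potential_def right_diff_distrib sum_subtractf)
  also have "\<dots> \<le> (\<Sum>l<m. w l * (\<Sum>i<n. \<Sum>j<n. plan v l i j * (v l j - v' l j)))"
    by (intro sum_mono mult_left_mono jensen) (auto simp: w_nonneg)
  finally have "potential v - potential v'
      \<le> (\<Sum>l<m. w l * (\<Sum>i<n. \<Sum>j<n. plan v l i j * (v l j - v' l j)))" .
  moreover have "(\<Sum>i<n. \<Sum>j<n. plan v l i j * (v l j - v' l j)) = (\<Sum>j<n. marg v l j * (v l j - v' l j))" for l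
    unfolding marg_def col_sums_def sum_distrib_right by (rule sum.swap)
  ultimately show ?thesis by simp
qed

text \<open>Centering makes the pairing with the common mean vanish.\<close>

lemma centered_pairing_le:
  assumes y: "centered y" and z: "\<And>l. l < m \<Longrightarrow> \<exists>z. \<forall>j<n. \<bar>y l j - z\<bar> \<le> R"
  shows "(\<Sum>l<m. w l * (\<Sum>j<n. (marg v l j - q j) * y l j)) \<le> R * residual v"
proof -
  define b where "b j = (\<Sum>k<m. w k * marg v k j)" for j
  \<comment> \<open>As \<open>h\<close> does not depend on \<open>l\<close>, centering kills it.
    With \<open>h = b - q\<close> this exchanges an arbitrary \<open>q\<close> for the mean marginal
    \<open>b\<close>.\<close>
  have zero: "(\<Sum>l<m. w l * (\<Sum>j<n. h j * y l j)) = 0" for h :: "nat \<Rightarrow> real"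
  proof -
    have "(\<Sum>l<m. w l * (\<Sum>j<n. h j * y l j)) = (\<Sum>j<n. h j * (\<Sum>l<m. w l * y l j))"
      unfolding sum_distrib_left by (subst sum.swap) (simp add: ac_simps)
    then show ?thesis using y by (simp add: centered_def)
  qed
  have "(\<Sum>l<m. w l * (\<Sum>j<n. (marg v l j - q j) * y l j))
      = (\<Sum>l<m. w l * (\<Sum>j<n. (marg v l j - b j) * y l j)) + (\<Sum>l<m. w l * (\<Sum>j<n. (b j - q j) * y l j))"
    by (simp add: left_diff_distrib right_diff_distrib sum_subtractf)
  also have "\<dots> = (\<Sum>l<m. w l * (\<Sum>j<n. (marg v l j - b j) * y l j))" by (simp add: zero)
  also have "\<dots> \<le> (\<Sum>l<m. w l * (R * (\<Sum>j<n. \<bar>marg v l j - b j\<bar>)))"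
  proof (intro sum_mono mult_left_mono)
    fix l assume "l \<in> {..<m}"
    then have l: "l < m" by simp
    obtain z where "\<forall>j<n. \<bar>y l j - z\<bar> \<le> R" using z[OF l] by blast
    then show "(\<Sum>j<n. (marg v l j - b j) * y l j) \<le> R * (\<Sum>j<n. \<bar>marg v l j - b j\<bar>)"
      using l by (intro sum_mult_le_of_balanced[where z = z])
        (auto simp: sum_subtractf marg_sum mean_marg_sum b_def)
  qed (auto simp: w_nonneg)
  also have "\<dots> = R * residual v"
    by (simp add: residual_eq b_def sum_distrib_left ac_simps)
  finally show ?thesis .
qed

text \<open>The difference \<open>v - v'\<close> is again centered and oscillates within twice the
  radius; convexity pairs it with the marginals, and the pairing bound applies with
  \<open>q = 0\<close>.\<close>

lemma potential_gap:
  assumes "centered v" "narrow v" "centered v'" "narrow v'"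
  shows "potential v - potential v' \<le> 2 * max_cost m n C / \<gamma> * residual v"
proof -
  define y where "y l j = v l j - v' l j" for l j
  have "centered y" using assms by (simp add: centered_def y_def right_diff_distrib sum_subtractf)
  moreover have "\<exists>z. \<forall>j<n. \<bar>y l j - z\<bar> \<le> 2 * max_cost m n C / \<gamma>" if l: "l < m" for l
  proof -
    obtain z z' where z: "\<forall>j<n. \<bar>v l j - z\<bar> \<le> max_cost m n C / \<gamma>"
      "\<forall>j<n. \<bar>v' l j - z'\<bar> \<le> max_cost m n C / \<gamma>"
      using assms(2,4) l unfolding narrow_def by meson
    have "\<bar>y l j - (z - z')\<bar> \<le> 2 * max_cost m n C / \<gamma>" if "j < n" for j
      using z[rule_format, OF that] by (simp add: y_def)
    then show ?thesis by blast
  qed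
  ultimately have "(\<Sum>l<m. w l * (\<Sum>j<n. (marg v l j - 0) * y l j))
      \<le> 2 * max_cost m n C / \<gamma> * residual v"
    by (rule centered_pairing_le)
  then show ?thesis using potential_convex[of v v'] by (simp add: y_def)
qed

section \<open>Accuracy of the mean column marginal\<close>

text \<open>The kernel form of the plan expresses \<open>C l\<close> through the scalings and
  \<open>ln B\<close>. The row scaling drops out because both plans have row marginal
  \<open>p l\<close>; the column scaling leaves the marginal defect.\<close>

lemma plan_cost_le:
  assumes l: "l < m" and pi: "\<pi> \<in> couplings n (p l) q"
  shows "mat_inner n (plan v l) (C l)
    \<le> mat_inner n \<pi> (C l) + \<gamma> * ((\<Sum>j<n. (marg v l j - q j) * v l j) + 2 * ln (real n))"
proof -
  define B where "B = plan v l"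
  define a where "a i = ln (x_update v l i)" for i
  have pi0: "0 \<le> \<pi> i j" if "i < n" "j < n" for i j using pi that by (simp add: couplings_def)
  have pi_row: "(\<Sum>j<n. \<pi> i j) = p l i" if "i < n" for i using pi that by (simp add: couplings_def)
  have pi_col: "(\<Sum>i<n. \<pi> i j) = q j" if "j < n" for j using pi that by (simp add: couplings_def)
  have B0: "0 \<le> B i j" if "i < n" for i j using plan_nonneg[OF l that] by (simp add: B_def)
  have B_row: "(\<Sum>j<n. B i j) = p l i" for i by (simp add: B_def plan_row_sum)
  have B_col: "(\<Sum>i<n. B i j) = marg v l j" for j by (simp add: B_def marg_def col_sums_def)
  have B1: "B i j \<le> 1" if "i < n" "j < n" for i j
  proof -
    have "B i j \<le> (\<Sum>j<n. B i j)" by (rule member_le_sum) (use that B0 in auto)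
    also have "\<dots> = p l i" by (rule B_row)
    also have "\<dots> \<le> (\<Sum>i<n. p l i)" by (rule member_le_sum) (use that p_nonneg l in auto)
    finally show ?thesis using p_sum[OF l] by simp
  qed
  have pt: "(B i j - \<pi> i j) * C l i j \<le> \<gamma> * ((B i j - \<pi> i j) * a i + (B i j - \<pi> i j) * v l j
      + (B i j * ln ((real n)\<^sup>2) + (1 / (real n)\<^sup>2 - B i j)))" if ij: "i < n" "j < n" for i j
  proof (cases "p l i = 0")
    \<comment> \<open>Both plans vanish on a row without mass, so the meaningless \<open>a i\<close>
      is multiplied by zero and only \<open>1 / (real n)\<^sup>2\<close> remains on the
      right.\<close>
    case True
    have "\<pi> i j \<le> (\<Sum>j<n. \<pi> i j)" by (rule member_le_sum) (use ij pi0 in auto)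
    then have "\<pi> i j = 0" using True pi_row ij pi0[of i j] by simp
    moreover have "B i j = 0" using True by (simp add: B_def plan_def x_update_def)
    ultimately show ?thesis using gamma_pos by simp
  next
    case False
    then have x: "0 < x_update v l i"
      using p_nonneg[OF l ij(1)] KV_pos by (simp add: x_update_def)
    then have Bpos: "0 < B i j" using kernel_pos by (simp add: B_def plan_def)
    have "ln (B i j) = a i - C l i j / \<gamma> + v l j"
      using x by (simp add: B_def plan_def a_def kernel_def ln_mult)
    then have C: "C l i j = \<gamma> * (a i + v l j - ln (B i j))" using gamma_pos by (simp add: field_simps)
    have "\<pi> i j * ln (B i j) \<le> 0"
      using pi0[OF ij] B1[OF ij] Bpos by (intro mult_nonneg_nonpos) auto
    moreover have "- (B i j * ln (B i j)) \<le> B i j * ln ((real n)\<^sup>2) + (1 / (real n)\<^sup>2 - B i j)"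
      using n_ge_2 B0[OF ij(1)] by (intro neg_mult_ln_le) auto
    ultimately have "(B i j - \<pi> i j) * (a i + v l j - ln (B i j))
        \<le> (B i j - \<pi> i j) * a i + (B i j - \<pi> i j) * v l j
          + (B i j * ln ((real n)\<^sup>2) + (1 / (real n)\<^sup>2 - B i j))"
      by (simp add: algebra_simps)
    then have "\<gamma> * ((B i j - \<pi> i j) * (a i + v l j - ln (B i j)))
        \<le> \<gamma> * ((B i j - \<pi> i j) * a i + (B i j - \<pi> i j) * v l j
          + (B i j * ln ((real n)\<^sup>2) + (1 / (real n)\<^sup>2 - B i j)))"
      using gamma_pos by (intro mult_left_mono) auto
    then show ?thesis by (subst C) (simp add: ac_simps)
  qed
  have rows: "(\<Sum>i<n. \<Sum>j<n. (B i j - \<pi> i j) * a i) = 0"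
    by (simp add: sum_subtractf B_row pi_row flip: sum_distrib_right)
  have cols: "(\<Sum>i<n. \<Sum>j<n. (B i j - \<pi> i j) * v l j) = (\<Sum>j<n. (marg v l j - q j) * v l j)"
    by (subst sum.swap) (simp add: sum_subtractf B_col pi_col flip: sum_distrib_right)
  have ent: "(\<Sum>i<n. \<Sum>j<n. B i j * ln ((real n)\<^sup>2) + (1 / (real n)\<^sup>2 - B i j)) = 2 * ln (real n)"
  proof -
    have "ln ((real n)\<^sup>2) = 2 * ln (real n)" using n_ge_2 by (simp add: ln_realpow)
    moreover have "(\<Sum>i<n. \<Sum>j<n. 1 / (real n)\<^sup>2) = 1" using n_ge_2 by (simp add: power2_eq_square)
    ultimately show ?thesis
      by (simp add: sum.distrib sum_subtractf B_row p_sum[OF l] flip: sum_distrib_right)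
  qed
  have "mat_inner n B (C l) - mat_inner n \<pi> (C l) = (\<Sum>i<n. \<Sum>j<n. (B i j - \<pi> i j) * C l i j)"
    by (simp add: mat_inner_def left_diff_distrib sum_subtractf)
  also have "\<dots> \<le> (\<Sum>i<n. \<Sum>j<n. \<gamma> * ((B i j - \<pi> i j) * a i + (B i j - \<pi> i j) * v l j
      + (B i j * ln ((real n)\<^sup>2) + (1 / (real n)\<^sup>2 - B i j))))"
    by (intro sum_mono pt) auto
  also have "\<dots> = \<gamma> * ((\<Sum>j<n. (marg v l j - q j) * v l j) + 2 * ln (real n))"
  proof -
    have split: "(\<Sum>i<n. \<Sum>j<n. \<gamma> * (P i j + Q i j + H i j))
        = \<gamma> * ((\<Sum>i<n. \<Sum>j<n. P i j) + (\<Sum>i<n. \<Sum>j<n. Q i j) + (\<Sum>i<n. \<Sum>j<n. H i j))"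
      for P Q H :: "nat \<Rightarrow> nat \<Rightarrow> real"
      by (simp add: sum.distrib flip: sum_distrib_left)
    show ?thesis unfolding split rows cols ent by simp
  qed
  finally show ?thesis by (simp add: B_def)
qed

text \<open>The factor \<open>3 / 2\<close> consists of 1 from pairing the centered \<open>v\<close>
  with the marginal defect and \<open>1 / 2\<close> from rounding to the mean marginal; the
  remaining term is entropy.\<close>

lemma bary_objective_mean_marg_le:
  assumes v: "centered v" "narrow v" and q: "q \<in> prob_simplex n"
  shows "bary_objective m n w p C (mean_col_sums m n w (plan v))
    \<le> bary_objective m n w p C q + 2 * \<gamma> * ln (real n) + 3 / 2 * max_cost m n C * residual v"
proof -
  define b where "b = mean_col_sums m n w (plan v)"
  define cm where "cm = max_cost m n C"
  have b: "b j = (\<Sum>k<m. w k * marg v k j)" for j by (simp add: b_def mean_col_sums_plan)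
  have each: "wasserstein n (C l) (p l) b \<le> wasserstein n (C l) (p l) q
      + \<gamma> * ((\<Sum>j<n. (marg v l j - q j) * v l j) + 2 * ln (real n))
      + cm / 2 * (\<Sum>j<n. \<bar>marg v l j - b j\<bar>)" if l: "l < m" for l
  proof -
    have "\<exists>\<pi>\<in>couplings n (p l) b. mat_inner n \<pi> (C l) \<le> mat_inner n (plan v l) (C l)
        + cm / 2 * (\<Sum>j<n. \<bar>col_sums n (plan v l) j - b j\<bar>)"
    proof (rule rounding_to_coupling)
      show "(\<Sum>j<n. b j) = (\<Sum>j<n. col_sums n (plan v l) j)"
        using mean_marg_sum marg_sum[OF l] by (simp add: b marg_def)
      show "0 \<le> b j" if "j < n" for j
        using mean_marg_simplex[of v] that by (simp add: b_def prob_simplex_def)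
    qed (use l in \<open>auto simp: plan_nonneg plan_row_sum C_nonneg cm_def
      intro: entry_le_max_cost marg_pos[unfolded marg_def]\<close>)
    then obtain \<pi> where pi: "\<pi> \<in> couplings n (p l) b" "mat_inner n \<pi> (C l) \<le> mat_inner n (plan v l) (C l)
        + cm / 2 * (\<Sum>j<n. \<bar>marg v l j - b j\<bar>)"
      unfolding marg_def by blast
    have "wasserstein n (C l) (p l) b \<le> mat_inner n \<pi> (C l)"
      by (rule wasserstein_le[OF pi(1)]) (use l C_nonneg in auto)
    moreover have "mat_inner n (plan v l) (C l)
        - \<gamma> * ((\<Sum>j<n. (marg v l j - q j) * v l j) + 2 * ln (real n)) \<le> wasserstein n (C l) (p l) q"
      using plan_cost_le[OF l, of _ q v] by (intro wasserstein_ge p_simplex l q) (simp add: algebra_simps)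
    ultimately show ?thesis using pi(2) by linarith
  qed
  have "bary_objective m n w p C b \<le> (\<Sum>l<m. w l * (wasserstein n (C l) (p l) q
      + \<gamma> * ((\<Sum>j<n. (marg v l j - q j) * v l j) + 2 * ln (real n))
      + cm / 2 * (\<Sum>j<n. \<bar>marg v l j - b j\<bar>)))"
    unfolding bary_objective_def by (intro sum_mono mult_left_mono each) (auto simp: w_nonneg)
  also have "\<dots> = bary_objective m n w p C q
      + \<gamma> * (\<Sum>l<m. w l * (\<Sum>j<n. (marg v l j - q j) * v l j))
      + \<gamma> * (2 * ln (real n)) * (\<Sum>l<m. w l) + cm / 2 * residual v"
  proof -
    have "(\<Sum>l<m. w l * (A l + \<gamma> * (B l + c) + d * E l)) = (\<Sum>l<m. w l * A l)
        + \<gamma> * (\<Sum>l<m. w l * B l) + \<gamma> * c * (\<Sum>l<m. w l) + d * (\<Sum>l<m. w l * E l)" for A B E c d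
      by (simp add: algebra_simps sum.distrib sum_distrib_left)
    then show ?thesis unfolding bary_objective_def residual_eq b .
  qed
  also have "\<dots> \<le> bary_objective m n w p C q + \<gamma> * (cm / \<gamma> * residual v)
      + \<gamma> * (2 * ln (real n)) * (\<Sum>l<m. w l) + cm / 2 * residual v"
    using v gamma_pos unfolding cm_def
    by (intro add_mono mult_left_mono centered_pairing_le order_refl) (auto simp: narrow_def)
  finally show ?thesis using gamma_pos w_sum by (simp add: b_def cm_def algebra_simps)
qed

end

section \<open>The algorithm and its operation count\<close>

lemma couplings_cong:
  assumes "\<And>j. j < n \<Longrightarrow> q j = q' j"
  shows "couplings n p q = couplings n p q'"
  using assms by (simp add: couplings_def)

text \<open>Vectors are functions on all naturals, and the output is identified only below
  \<open>n\<close>.\<close>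

lemma bary_objective_cong:
  assumes "\<And>j. j < n \<Longrightarrow> q j = q' j"
  shows "bary_objective m n w p C q = bary_objective m n w p C q'"
  using couplings_cong[OF assms] by (simp add: bary_objective_def wasserstein_def)

section \<open>Values and operation counts of the building blocks\<close>

lemma fst_bind_counted [simp]: "fst (bind_counted c f) = fst (f (fst c))"
  and snd_bind_counted [simp]: "snd (bind_counted c f) = snd c + snd (f (fst c))"
  by (simp_all add: bind_counted_def)

lemma fst_ret [simp]: "fst (ret x) = x" and snd_ret [simp]: "snd (ret x) = 0"
  by (simp_all add: ret_def)

lemma fst_tick [simp]: "fst (tick x) = x" and snd_tick [simp]: "snd (tick x) = 1"
  by (simp_all add: tick_def)

lemma fst_cvec [simp]: "i < k \<Longrightarrow> fst (cvec k f) i = fst (f i)"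
  by (induction k) (auto simp: less_Suc_eq)

lemma snd_cvec [simp]: "snd (cvec k f) = (\<Sum>i<k. snd (f i))"
  by (induction k) auto

lemma fst_csum [simp]: "fst (csum k f) = (\<Sum>i<k. fst (f i :: 'a::comm_monoid_add counted))"
  by (induction k) auto

lemma snd_csum [simp]: "snd (csum k f) = (\<Sum>i<k. snd (f i)) + k"
  by (induction k) auto

lemma eln_pos: "0 < x \<Longrightarrow> eln x = ereal (ln x)"
  by (simp add: eln_def)

lemma eexp_ereal [simp]: "eexp (ereal x) = exp x"
  by (simp add: eexp_def)

text \<open>\<open>iteration_cost\<close> speaks of half-steps only. The test calls
  \<open>mulT\<close> on the same exponentials as the \<open>v\<close> half-step and is therefore
  charged to it.\<close>

lemma residual_test_cost_le:
  assumes "2 \<le> n"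
  shows "snd (residual_test m n w mulT s) \<le> 2 * snd (v_iter m n w mulT s)"
proof -
  obtain u v where s: "s = (u, v)" by (cases s)
  define c where "c = (\<Sum>l<m. snd (mulT l (fst (cvec n (\<lambda>i. tick (eexp (u l i)))))))"
  have "2 * m \<le> n * m" using assms by (intro mult_le_mono1)
  moreover have "snd (residual_test m n w mulT s) = 8 * (n * m) + 2 * m + c"
    by (simp add: s residual_test_def sum.distrib algebra_simps flip: c_def)
  moreover have "snd (v_iter m n w mulT s) = 5 * (n * m) + c"
    by (simp add: s v_iter_def sum.distrib algebra_simps flip: c_def)
  ultimately show ?thesis by linarith
qed

lemma averaging_cost: "snd (averaging m n w c) = 3 * m * n + 2 * m + n + 1"
  by (simp add: averaging_def sum.distrib algebra_simps)

lemma set_params_eq: "set_params m n C \<epsilon> = ((reg_param n \<epsilon>, stop_param m n C \<epsilon>), 6)"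
  by (simp add: set_params_def bind_counted_def tick_def ret_def reg_param_def stop_param_def)

context barycenter_problem
begin

section \<open>Real iterates and the number of passes\<close>

text \<open>One index per pass, that is per two half-steps: \<open>xs k\<close> is the exponential
  of \<open>u\<close> after \<open>2 * k\<close> of them, so the start \<open>u = 0\<close> becomes
  1.\<close>

primrec xs :: "nat \<Rightarrow> nat \<Rightarrow> nat \<Rightarrow> real" where
  "xs 0 = (\<lambda>l i. 1)"
| "xs (Suc k) = x_update (v_update (xs k))"

text \<open>Computed from \<open>xs k\<close>, but tested together with \<open>xs (Suc k)\<close> at
  the end of the same pass.\<close>

definition vs :: "nat \<Rightarrow> nat \<Rightarrow> nat \<Rightarrow> real" where
  "vs k = v_update (xs k)"

lemma positive_mass_xs: "positive_mass (xs k)"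
proof (cases k)
  case 0
  then show ?thesis using n_ge_2 by (simp add: positive_mass_def)
qed (simp add: positive_mass_x_update)

lemma xs_Suc: "xs (Suc k) = x_update (vs k)"
  by (simp add: vs_def)

lemma vs_Suc: "vs (Suc k) = v_update (x_update (vs k))"
  by (simp add: vs_def)

lemma centered_vs: "centered (vs k)" and narrow_vs: "narrow (vs k)"
  by (simp_all add: vs_def centered_v_update narrow_v_update positive_mass_xs)

text \<open>A residual above \<open>e\<close> in the first \<open>2 * N\<close> passes would
  contradict the descent bound with \<open>c = 16\<close> and
  \<open>R = 2 * max_cost m n C / \<gamma>\<close>.\<close>

lemma residual_vs_le:
  assumes "0 < e" and "32 * max_cost m n C / \<gamma> < real N * e"
  shows "\<exists>k < 2 * N. residual (vs k) \<le> e"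
proof (rule ccontr)
  assume neg: "\<not> ?thesis"
  have "real N * e \<le> 16 * (2 * max_cost m n C / \<gamma>)"
  proof (rule descent_steps_bound)
    show "e < residual (vs k)" if "k < 2 * N" for k using neg that by auto
    show "(residual (vs k))\<^sup>2 \<le> 16 * (potential (vs k) - potential (vs (Suc k)))" for k
      unfolding vs_Suc by (rule potential_descent[OF centered_vs])
    show "potential (vs k) - potential (vs (2 * N)) \<le> 2 * max_cost m n C / \<gamma> * residual (vs k)" for k
      by (intro potential_gap centered_vs narrow_vs)
  qed (use assms max_cost_pos gamma_pos in auto)
  then show False using assms by simp
qed

section \<open>Agreement with the extended-real recursion\<close>

text \<open>Only the exponential is compared, because \<open>u\<close> may be
  \<open>-\<infinity>\<close>. Indices are restricted since \<open>cvec\<close> leaves entries out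
  of range unspecified.\<close>

definition u_represents :: "(nat \<Rightarrow> nat \<Rightarrow> ereal) \<Rightarrow> (nat \<Rightarrow> nat \<Rightarrow> real) \<Rightarrow> bool" where
  "u_represents u x \<longleftrightarrow> (\<forall>l<m. \<forall>i<n. eexp (u l i) = x l i)"

definition v_represents :: "(nat \<Rightarrow> nat \<Rightarrow> ereal) \<Rightarrow> (nat \<Rightarrow> nat \<Rightarrow> real) \<Rightarrow> bool" where
  "v_represents v y \<longleftrightarrow> (\<forall>l<m. \<forall>j<n. v l j = ereal (y l j))"

lemma KT_represented:
  "u_represents u x \<Longrightarrow> l < m \<Longrightarrow> (\<Sum>i<n. kernel \<gamma> (C l) i j * eexp (u l i)) = KT x l j"
  by (simp add: u_represents_def KT_def)

text \<open>Positivity of \<open>KT x\<close> keeps all logarithms finite, so the extended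
  arithmetic is real arithmetic. An abstract \<open>y\<close> serves both the recursion and its
  counted version.\<close>

lemma v_update_represented:
  assumes "\<And>k. k < m \<Longrightarrow> y k = eln (KT x k j)" "positive_mass x" "l < m" "j < n"
  shows "(\<Sum>k<m. ereal (w k) * y k) - y l = ereal (v_update x l j)"
  using assms KT_pos by (simp add: eln_pos v_update_def)

text \<open>If \<open>p l i\<close> vanishes, the difference is \<open>-\<infinity>\<close>, whose
  exponential 0 equals the real quotient.\<close>

lemma x_update_represented:
  assumes "l < m" "i < n"
  shows "eexp (eln (p l i) - eln (KV y l i)) = x_update y l i"
proof (cases "p l i = 0")
  case True
  then show ?thesis using KV_pos[of y l i] by (simp add: eln_def eexp_def x_update_def)
next
  case False
  then have "0 < p l i" using p_nonneg[OF assms] by simp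
  then show ?thesis using KV_pos[of y l i] by (simp add: eln_pos exp_diff x_update_def)
qed

text \<open>A pass recomputes \<open>v\<close> from \<open>u\<close> alone, so the invariant between
  passes concerns \<open>u\<close> only.\<close>

lemma step_represented:
  assumes "u_represents (fst s) (xs k)"
  defines "s' \<equiv> u_step n p C \<gamma> (v_step m n w C \<gamma> s)"
  shows "u_represents (fst s') (xs (Suc k))" and "v_represents (snd s') (vs k)"
proof -
  have v: "v_represents (snd s') (vs k)"
    unfolding v_represents_def s'_def vs_def
    by (auto simp: u_step_def v_step_def case_prod_unfold KT_represented[OF assms(1)]
        intro!: v_update_represented positive_mass_xs)
  have snd_eq: "snd s' = snd (v_step m n w C \<gamma> s)"
    by (simp add: s'_def u_step_def case_prod_unfold)
  have "(\<Sum>j<n. kernel \<gamma> (C l) i j * eexp (snd s' l j)) = KV (vs k) l i" if "l < m" for l i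
    using v that by (simp add: v_represents_def KV_def)
  then show "u_represents (fst s') (xs (Suc k))"
    unfolding u_represents_def xs_Suc snd_eq
    by (auto simp: s'_def u_step_def case_prod_unfold x_update_represented)
  show "v_represents (snd s') (vs k)" by (rule v)
qed

lemma dibp_loop:
  "dibp m n w p C \<gamma> (2 * Suc k) = u_step n p C \<gamma> (v_step m n w C \<gamma> (dibp m n w p C \<gamma> (2 * k)))"
  by simp

lemma dibp_represented: "u_represents (fst (dibp m n w p C \<gamma> (2 * k))) (xs k)"
proof (induction k)
  case 0
  then show ?case by (simp add: u_represents_def eexp_def)
next
  case (Suc k)
  then show ?case unfolding dibp_loop by (rule step_represented)
qed

lemma dibp_mat_eq:
  assumes "l < m" "i < n" "j < n"
  shows "dibp_mat m n w p C \<gamma> (2 * Suc k) l i j = plan (vs k) l i j"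
  using step_represented[OF dibp_represented[of k]] assms
  unfolding dibp_mat_def scaled_kernel_def dibp_loop u_represents_def v_represents_def
  by (simp add: plan_def vs_def)

lemma col_sums_dibp_mat:
  "l < m \<Longrightarrow> j < n \<Longrightarrow> col_sums n (dibp_mat m n w p C \<gamma> (2 * Suc k) l) j = marg (vs k) l j"
  unfolding col_sums_def marg_def by (intro sum.cong refl dibp_mat_eq) auto

lemma col_residual_dibp_mat: "col_residual m n w (dibp_mat m n w p C \<gamma> (2 * Suc k)) = residual (vs k)"
  unfolding col_residual_def residual_eq mean_col_sums_def
  by (intro sum.cong refl arg_cong2[where f = "(*)"])
    (auto simp: col_sums_dibp_mat simp del: mult_Suc_right intro!: sum.cong)

lemma dibp_stops_iff:
  "dibp_stops m n w p C \<gamma> e t \<longleftrightarrow> (\<exists>k. t = 2 * Suc k \<and> residual (vs k) \<le> e)"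
proof
  assume t: "dibp_stops m n w p C \<gamma> e t"
  then obtain k where "t = 2 * Suc k" unfolding dibp_stops_def
    by (metis dvdE gr0_implies_Suc nat_0_less_mult_iff)
  then show "\<exists>k. t = 2 * Suc k \<and> residual (vs k) \<le> e"
    using t col_residual_dibp_mat unfolding dibp_stops_def by auto
next
  assume "\<exists>k. t = 2 * Suc k \<and> residual (vs k) \<le> e"
  then obtain k where k: "t = 2 * Suc k" "residual (vs k) \<le> e" by blast
  show "dibp_stops m n w p C \<gamma> e t"
    unfolding dibp_stops_def k(1) col_residual_dibp_mat using k(2) by simp
qed

text \<open>After a row update each plan has the mass of \<open>p l\<close>, which is one; the
  normalising factor is therefore 1.\<close>

lemma normalized_mean_dibp_output:
  assumes k: "residual (vs k) \<le> e" "\<And>k'. k' < k \<Longrightarrow> \<not> residual (vs k') \<le> e" and j: "j < n"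
  shows "normalized_mean m n w (dibp_output m n w p C \<gamma> e) j = mean_col_sums m n w (plan (vs k)) j"
proof -
  have "(LEAST t. dibp_stops m n w p C \<gamma> e t) = 2 * Suc k"
    using k by (intro Least_equality) (auto simp: dibp_stops_iff not_less[symmetric])
  then have out: "dibp_output m n w p C \<gamma> e = dibp_mat m n w p C \<gamma> (2 * Suc k)"
    by (simp only: dibp_output_def)
  have mass: "(\<Sum>i<n. \<Sum>j<n. dibp_mat m n w p C \<gamma> (2 * Suc k) l i j) = 1" if "l < m" for l
  proof -
    have "(\<Sum>i<n. \<Sum>j<n. dibp_mat m n w p C \<gamma> (2 * Suc k) l i j) = (\<Sum>i<n. \<Sum>j<n. plan (vs k) l i j)"
      using that by (intro sum.cong refl dibp_mat_eq) auto
    then show ?thesis using that by (simp add: plan_row_sum p_sum)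
  qed
  have "(\<Sum>l<m. w l * (\<Sum>i<n. \<Sum>j<n. dibp_mat m n w p C \<gamma> (2 * Suc k) l i j)) = (\<Sum>l<m. w l)"
    by (intro sum.cong refl) (simp add: mass del: mult_Suc_right)
  moreover have "(\<Sum>l<m. w l * col_sums n (dibp_mat m n w p C \<gamma> (2 * Suc k) l) j)
      = (\<Sum>l<m. w l * marg (vs k) l j)"
    by (intro sum.cong refl) (simp add: col_sums_dibp_mat j del: mult_Suc_right)
  ultimately show ?thesis
    unfolding normalized_mean_def out mean_col_sums_plan w_sum by simp
qed

section \<open>The counted loop\<close>

text \<open>The routines only replace the kernel products, so the reduced iteration is followed
  exactly. The budget \<open>4 * M\<close> is two half-steps plus a test worth two more.\<close>

lemma loop_body_represented:
  assumes routines: "kernel_routines m n C \<gamma> mul mulT"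
    and cost: "iteration_cost m n w p mul mulT M"
    and s: "u_represents (fst s) (xs k)"
  obtains s' c a where "loop_body m n w p mul mulT s = ((s', c, residual (vs k)), a)"
    and "u_represents (fst s') (xs (Suc k))"
    and "\<And>l j. l < m \<Longrightarrow> j < n \<Longrightarrow> c l j = marg (vs k) l j"
    and "real a \<le> 4 * M"
proof -
  have mul: "fst (mul l x) i = (\<Sum>j<n. kernel \<gamma> (C l) i j * x j)"
    and mulT: "fst (mulT l x) i = (\<Sum>j<n. kernel \<gamma> (C l) j i * x j)" if "l < m" "i < n" for l i x
    using routines that by (auto simp: kernel_routines_def)
  define s1 where "s1 = fst (v_iter m n w mulT s)"
  define s2 where "s2 = fst (u_iter m n p mul s1)"
  define cr where "cr = fst (residual_test m n w mulT s2)"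
  define a where "a = snd (v_iter m n w mulT s) + snd (u_iter m n p mul s1) + snd (residual_test m n w mulT s2)"
  have v1: "v_represents (snd s1) (vs k)"
    unfolding v_represents_def vs_def s1_def
    by (auto simp: v_iter_def case_prod_unfold mulT KT_represented[OF s]
        intro!: v_update_represented positive_mass_xs)
  have v2: "v_represents (snd s2) (vs k)"
    using v1 by (simp add: s2_def u_iter_def case_prod_unfold)
  have KVeq: "(\<Sum>j<n. kernel \<gamma> (C l) i j * eexp (snd s1 l j)) = KV (vs k) l i" if "l < m" for l i
    using v1 that by (simp add: v_represents_def KV_def)
  have u2: "u_represents (fst s2) (xs (Suc k))"
    unfolding u_represents_def xs_Suc
    by (auto simp: s2_def u_iter_def case_prod_unfold mul KVeq x_update_represented)
  have c: "fst cr l j = marg (vs k) l j" if "l < m" "j < n" for l j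
    using v2 that KT_represented[OF u2] unfolding v_represents_def
    by (simp add: cr_def residual_test_def case_prod_unfold mulT marg_eq xs_Suc del: xs.simps)
  have r: "snd cr = residual (vs k)"
  proof -
    have "snd cr = (\<Sum>l<m. w l * (\<Sum>j<n. \<bar>fst cr l j - (\<Sum>l<m. w l * fst cr l j)\<bar>))"
      by (simp add: cr_def residual_test_def case_prod_unfold)
    also have "\<dots> = residual (vs k)" unfolding residual_eq
      by (intro sum.cong refl arg_cong2[where f = "(*)"]) (auto simp: c intro!: sum.cong)
    finally show ?thesis .
  qed
  have "loop_body m n w p mul mulT s = ((s2, cr), a)"
    by (simp add: loop_body_def s1_def s2_def cr_def a_def prod_eq_iff)
  then have "loop_body m n w p mul mulT s = ((s2, fst cr, residual (vs k)), a)"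
    by (simp flip: r)
  moreover have "real a \<le> 4 * M"
  proof -
    have "real (snd (v_iter m n w mulT s)) \<le> M" "real (snd (v_iter m n w mulT s2)) \<le> M"
      "real (snd (u_iter m n p mul s1)) \<le> M"
      using cost unfolding iteration_cost_def by blast+
    then show ?thesis using residual_test_cost_le[OF n_ge_2, of m w mulT s2] unfolding a_def by simp
  qed
  ultimately show ?thesis using that u2 c by blast
qed

text \<open>Induction on the number \<open>d\<close> of passes that fail the test; the successful
  pass is one more, hence \<open>Suc d\<close>.\<close>

lemma repeat_until_represented:
  assumes routines: "kernel_routines m n C \<gamma> mul mulT"
    and cost: "iteration_cost m n w p mul mulT M"
    and stop: "residual (vs K) \<le> e" "\<And>k. k < K \<Longrightarrow> \<not> residual (vs k) \<le> e"
    and s: "u_represents (fst s) (xs k)" and k: "k + d = K"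
  shows "\<exists>c a. repeat_until (loop_body m n w p mul mulT) e s c a
    \<and> (\<forall>l<m. \<forall>j<n. c l j = marg (vs K) l j) \<and> real a \<le> 4 * M * real (Suc d)"
  using s k
proof (induction d arbitrary: s k)
  case 0
  have kK: "k = K" using 0(2) by simp
  obtain s' c a where body: "loop_body m n w p mul mulT s = ((s', c, residual (vs K)), a)"
    "\<And>l j. l < m \<Longrightarrow> j < n \<Longrightarrow> c l j = marg (vs K) l j" "real a \<le> 4 * M"
    using loop_body_represented[OF routines cost 0(1)] unfolding kK by metis
  have "repeat_until (loop_body m n w p mul mulT) e s c a"
    by (rule repeat_until.stop) (rule body(1), rule stop(1))
  then show ?case using body(2,3) by (intro exI[of _ c] exI[of _ a]) simp
next
  case (Suc d)
  obtain s' c a where body: "loop_body m n w p mul mulT s = ((s', c, residual (vs k)), a)"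
    "u_represents (fst s') (xs (Suc k))" "real a \<le> 4 * M"
    using loop_body_represented[OF routines cost Suc.prems(1)] by metis
  obtain c' a' where rest: "repeat_until (loop_body m n w p mul mulT) e s' c' a'"
    "\<forall>l<m. \<forall>j<n. c' l j = marg (vs K) l j" "real a' \<le> 4 * M * real (Suc d)"
    using Suc.IH[OF body(2)] Suc.prems(2) by auto
  have "\<not> residual (vs k) \<le> e" using stop(2) Suc.prems(2) by simp
  with body(1) have "repeat_until (loop_body m n w p mul mulT) e s c' (a + a')"
    using rest(1) by (rule repeat_until.again)
  moreover have "real (a + a') \<le> 4 * M * real (Suc (Suc d))"
    using body(3) rest(3) by (simp add: algebra_simps)
  ultimately show ?case using rest(2) by blast
qed

lemma averaging_eq:
  assumes "\<And>l j. l < m \<Longrightarrow> j < n \<Longrightarrow> c l j = marg v l j" and "j < n"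
  shows "fst (averaging m n w c) j = mean_col_sums m n w (plan v) j"
proof -
  have "(\<Sum>l<m. w l * (\<Sum>j<n. c l j)) = (\<Sum>l<m. w l)"
    by (intro sum.cong refl) (simp add: assms(1) marg_sum)
  then show ?thesis using assms by (simp add: averaging_def mean_col_sums_plan w_sum)
qed

end

section \<open>Prescribed parameters and final bounds\<close>

lemma barycenter_problem_reg_param:
  assumes "bary_instance m n w p C" "0 < \<epsilon>"
  shows "barycenter_problem m n w p C (reg_param n \<epsilon>)"
  using assms by unfold_locales (auto simp: reg_param_def bary_instance_def)

lemma first_stopping_loop:
  fixes \<epsilon> :: real
  assumes inst: "bary_instance m n w p C" and eps: "0 < \<epsilon>"
  obtains k where
    "barycenter_problem.residual m n w p C (reg_param n \<epsilon>) (barycenter_problem.vs m n w p C (reg_param n \<epsilon>) k)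
      \<le> stop_param m n C \<epsilon>"
    "\<And>k'. k' < k \<Longrightarrow> \<not> barycenter_problem.residual m n w p C (reg_param n \<epsilon>)
      (barycenter_problem.vs m n w p C (reg_param n \<epsilon>) k') \<le> stop_param m n C \<epsilon>"
    "real (Suc k) \<le> 1024 * ((max_cost m n C / \<epsilon>)\<^sup>2 * ln (real n)) + 2"
proof -
  interpret barycenter_problem m n w p C "reg_param n \<epsilon>"
    by (rule barycenter_problem_reg_param[OF assms])
  define X where "X = (max_cost m n C / \<epsilon>)\<^sup>2 * ln (real n)"
  \<comment> \<open>The 512 is the 32 of the pass bound times the inverses of the two factors
    \<open>1/4\<close> in the parameters; \<open>N\<close> is the least integer beyond
    \<open>512 * X\<close>.\<close>
  define N where "N = nat \<lfloor>512 * X\<rfloor> + 1"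
  define P where "P k \<longleftrightarrow> residual (vs k) \<le> stop_param m n C \<epsilon>" for k
  have ln_pos: "0 < ln (real n)" using n_ge_2 by simp
  then have X: "0 \<le> X" by (simp add: X_def)
  have N: "512 * X < real N" "real N \<le> 512 * X + 1" using X by (auto simp: N_def) linarith+
  have e: "0 < stop_param m n C \<epsilon>" using eps max_cost_pos by (simp add: stop_param_def)
  have "32 * max_cost m n C / reg_param n \<epsilon> = 512 * X * stop_param m n C \<epsilon>"
    using eps max_cost_pos ln_pos
    by (simp add: X_def reg_param_def stop_param_def power2_eq_square field_simps)
  also have "\<dots> < real N * stop_param m n C \<epsilon>" using N e by simp
  finally obtain k0 where k0: "k0 < 2 * N" "P k0" using residual_vs_le[OF e] unfolding P_def by blast
  have "real (Suc (LEAST k. P k)) \<le> 2 * real N"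
    using Least_le[of P, OF k0(2)] k0(1) by linarith
  also have "\<dots> \<le> 1024 * X + 2" using N by simp
  finally show ?thesis
    using that[of "LEAST k. P k"] LeastI[of P, OF k0(2)] not_less_Least[of _ P]
    unfolding P_def X_def by blast
qed

lemma approx_barycenter_accuracy:
  fixes \<epsilon> :: real
  assumes inst: "bary_instance m n w p C" and eps: "0 < \<epsilon>"
  shows "\<exists>t. dibp_stops m n w p C (reg_param n \<epsilon>) (stop_param m n C \<epsilon>) t"
    and "approx_barycenter m n w p C \<epsilon> \<in> prob_simplex n"
    and "q \<in> prob_simplex n \<Longrightarrow> bary_objective m n w p C (approx_barycenter m n w p C \<epsilon>)
      - bary_objective m n w p C q \<le> \<epsilon>"
proof -
  interpret barycenter_problem m n w p C "reg_param n \<epsilon>"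
    by (rule barycenter_problem_reg_param[OF assms])
  obtain k where k: "residual (vs k) \<le> stop_param m n C \<epsilon>"
    "\<And>k'. k' < k \<Longrightarrow> \<not> residual (vs k') \<le> stop_param m n C \<epsilon>"
    using first_stopping_loop[OF assms] by metis
  show "\<exists>t. dibp_stops m n w p C (reg_param n \<epsilon>) (stop_param m n C \<epsilon>) t"
    using k(1) dibp_stops_iff by blast
  have out: "approx_barycenter m n w p C \<epsilon> j = mean_col_sums m n w (plan (vs k)) j" if "j < n" for j
    unfolding approx_barycenter_def by (rule normalized_mean_dibp_output[OF k that])
  show "approx_barycenter m n w p C \<epsilon> \<in> prob_simplex n"
    using mean_marg_simplex[of "vs k"] out by (simp add: prob_simplex_def)
  assume q: "q \<in> prob_simplex n"
  have "bary_objective m n w p C (approx_barycenter m n w p C \<epsilon>)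
      = bary_objective m n w p C (mean_col_sums m n w (plan (vs k)))"
    by (rule bary_objective_cong) (rule out)
  also have "\<dots> \<le> bary_objective m n w p C q + 2 * reg_param n \<epsilon> * ln (real n)
      + 3 / 2 * max_cost m n C * residual (vs k)"
    by (rule bary_objective_mean_marg_le[OF centered_vs narrow_vs q])
  also have "\<dots> \<le> bary_objective m n w p C q + 2 * reg_param n \<epsilon> * ln (real n)
      + 3 / 2 * max_cost m n C * stop_param m n C \<epsilon>"
    using k(1) max_cost_pos by simp
  \<comment> \<open>The error budget: \<open>\<epsilon> / 2\<close> for the entropy and
    \<open>3 / 8 * \<epsilon>\<close> for the residual.\<close>
  also have "2 * reg_param n \<epsilon> * ln (real n) = \<epsilon> / 2" using n_ge_2 by (simp add: reg_param_def)
  also have "3 / 2 * max_cost m n C * stop_param m n C \<epsilon> = 3 / 8 * \<epsilon>"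
    using max_cost_pos by (simp add: stop_param_def)
  finally show "bary_objective m n w p C (approx_barycenter m n w p C \<epsilon>)
      - bary_objective m n w p C q \<le> \<epsilon>" using eps by simp
qed

text \<open>At most \<open>1024 * X + 2\<close> passes of \<open>4 * M\<close> operations each. The
  hypothesis on \<open>a\<close> bounds \<open>X\<close> away from zero, so that the two additional
  passes are absorbed.\<close>

lemma procedure_run_bound:
  fixes \<epsilon> :: real
  assumes inst: "bary_instance m n w p C" and eps: "0 < \<epsilon>" and a: "0 < a" "\<epsilon> \<le> a * max_cost m n C"
    and routines: "kernel_routines m n C (reg_param n \<epsilon>) (mul (reg_param n \<epsilon>)) (mulT (reg_param n \<epsilon>))"
    and cost: "iteration_cost m n w p (mul (reg_param n \<epsilon>)) (mulT (reg_param n \<epsilon>)) M"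
  shows "\<exists>q k. procedure_run m n w p C \<epsilon> mul mulT q k
    \<and> (\<forall>j<n. q j = approx_barycenter m n w p C \<epsilon> j)
    \<and> real k \<le> (4096 + 8 * a\<^sup>2 / ln 2 + 9)
        * ((max_cost m n C / \<epsilon>)\<^sup>2 * M * ln (real n) + real m * real n)"
proof -
  let ?\<gamma> = "reg_param n \<epsilon>" and ?e = "stop_param m n C \<epsilon>"
  interpret barycenter_problem m n w p C ?\<gamma>
    by (rule barycenter_problem_reg_param[OF inst eps])
  define X where "X = (max_cost m n C / \<epsilon>)\<^sup>2 * ln (real n)"
  obtain K where K: "residual (vs K) \<le> ?e" "\<And>k'. k' < K \<Longrightarrow> \<not> residual (vs k') \<le> ?e"
    and K_le: "real (Suc K) \<le> 1024 * X + 2"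
    using first_stopping_loop[OF inst eps] unfolding X_def by metis
  have "u_represents (fst ((\<lambda>l i. 0), (\<lambda>l j. 0 :: ereal))) (xs 0)"
    by (simp add: u_represents_def eexp_def)
  from repeat_until_represented[OF routines cost K this, of K] obtain c b
    where run: "repeat_until (loop_body m n w p (mul ?\<gamma>) (mulT ?\<gamma>)) ?e ((\<lambda>l i. 0), (\<lambda>l j. 0)) c b"
      and c: "\<forall>l<m. \<forall>j<n. c l j = marg (vs K) l j" and b: "real b \<le> 4 * M * real (Suc K)"
    by auto
  define q where "q = fst (averaging m n w c)"
  define k where "k = 6 + b + (3 * m * n + 2 * m + n + 1)"
  have "averaging m n w c = (q, 3 * m * n + 2 * m + n + 1)"
    by (simp add: q_def prod_eq_iff averaging_cost)
  then have "procedure_run m n w p C \<epsilon> mul mulT q k"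
    unfolding procedure_run_def k_def set_params_eq using run by blast
  moreover have "q j = approx_barycenter m n w p C \<epsilon> j" if "j < n" for j
    using averaging_eq[of c "vs K" j] normalized_mean_dibp_output[OF K that] c that
    by (simp add: q_def approx_barycenter_def)
  moreover have "real k \<le> (4096 + 8 * a\<^sup>2 / ln 2 + 9) * (X * M + real m * real n)"
  proof -
    have M: "0 \<le> M" using cost unfolding iteration_cost_def by (meson of_nat_0_le_iff order_trans)
    have ln2: "0 < ln (2::real)" "ln 2 \<le> ln (real n)" using n_ge_2 by auto
    have "1 / a \<le> max_cost m n C / \<epsilon>" using a eps by (simp add: field_simps)
    then have "(1 / a)\<^sup>2 \<le> (max_cost m n C / \<epsilon>)\<^sup>2" using a by (intro power_mono) auto
    then have "(1 / a)\<^sup>2 * ln 2 \<le> X" unfolding X_def using ln2 by (intro mult_mono) auto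
    \<comment> \<open>This prices the two additional passes and is the source of
      \<open>8 * a\<^sup>2 / ln 2\<close>.\<close>
    then have "1 \<le> a\<^sup>2 / ln 2 * X" using a ln2 by (simp add: field_simps)
    then have "real (Suc K) \<le> 1024 * X + 2 * (a\<^sup>2 / ln 2 * X)" using K_le by linarith
    then have "4 * M * real (Suc K) \<le> 4 * M * (1024 * X + 2 * (a\<^sup>2 / ln 2 * X))"
      using M by (intro mult_left_mono) auto
    then have loops: "real b \<le> (4096 + 8 * a\<^sup>2 / ln 2) * (X * M)" using b by (simp add: algebra_simps)
    have X0: "0 \<le> X * M" using M n_ge_2 unfolding X_def by (intro mult_nonneg_nonneg) auto
    have A0: "0 \<le> 8 * a\<^sup>2 / ln 2" using ln2 by simp
    \<comment> \<open>Beyond \<open>3 * m * n\<close>, the terms \<open>2 * m\<close> and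
      \<open>n\<close> take one multiple of \<open>m * n\<close> each and the constant 7 takes four,
      which makes 9.\<close>
    have "m * 2 \<le> m * n" "1 * n \<le> m * n" using n_ge_2 m_pos by (intro mult_le_mono; simp)+
    moreover have "2 \<le> m * n" using calculation n_ge_2 by linarith
    ultimately have "6 + (3 * m * n + 2 * m + n + 1) \<le> 9 * (m * n)"
      unfolding mult.assoc by linarith
    then have "real (6 + (3 * m * n + 2 * m + n + 1)) \<le> real (9 * (m * n))" by (rule of_nat_mono)
    then have "real k \<le> real b + 9 * (real m * real n)" unfolding k_def by simp
    also have "\<dots> \<le> (4096 + 8 * a\<^sup>2 / ln 2) * (X * M) + 9 * (real m * real n)" using loops by simp
    also have "\<dots> \<le> (4096 + 8 * a\<^sup>2 / ln 2 + 9) * (X * M + real m * real n)"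
    proof -
      have "A * Y + 9 * Z \<le> (A + 9) * (Y + Z)" if "0 \<le> A" "0 \<le> Y" "0 \<le> Z" for A Y Z :: real
        using that mult_nonneg_nonneg[of A Z] by (simp add: algebra_simps)
      then show ?thesis by this (use X0 A0 in auto)
    qed
    finally show ?thesis .
  qed
  ultimately show ?thesis unfolding X_def by (intro exI[of _ q] exI[of _ k]) (simp add: ac_simps)
qed

theorem theorem2:
  "(\<forall>m n (w :: nat \<Rightarrow> real) (p :: nat \<Rightarrow> nat \<Rightarrow> real) (C :: nat \<Rightarrow> nat \<Rightarrow> nat \<Rightarrow> real) (\<epsilon> :: real).
      bary_instance m n w p C \<and> 0 < \<epsilon> \<longrightarrow>
        (\<exists>t. dibp_stops m n w p C (reg_param n \<epsilon>) (stop_param m n C \<epsilon>) t)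
      \<and> approx_barycenter m n w p C \<epsilon> \<in> prob_simplex n
      \<and> (\<forall>q_opt. is_arg_min (bary_objective m n w p C) (\<lambda>q. q \<in> prob_simplex n) q_opt \<longrightarrow>
            bary_objective m n w p C (approx_barycenter m n w p C \<epsilon>)
              - bary_objective m n w p C q_opt \<le> \<epsilon>))
   \<and>
   (\<forall>a>0. \<exists>K :: real. \<forall>m n (w :: nat \<Rightarrow> real) (p :: nat \<Rightarrow> nat \<Rightarrow> real)
        (C :: nat \<Rightarrow> nat \<Rightarrow> nat \<Rightarrow> real) (\<epsilon> :: real) mul mulT (M :: nat \<Rightarrow> nat \<Rightarrow> real).
      bary_instance m n w p C \<and> 0 < \<epsilon> \<and> \<epsilon> \<le> a * max_cost m n C
      \<and> kernel_routines m n C (reg_param n \<epsilon>) (mul (reg_param n \<epsilon>)) (mulT (reg_param n \<epsilon>))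
      \<and> iteration_cost m n w p (mul (reg_param n \<epsilon>)) (mulT (reg_param n \<epsilon>)) (M m n) \<longrightarrow>
        (\<exists>q k. procedure_run m n w p C \<epsilon> mul mulT q k
             \<and> (\<forall>j<n. q j = approx_barycenter m n w p C \<epsilon> j)
             \<and> real k \<le> K * ((max_cost m n C / \<epsilon>)\<^sup>2 * M m n * ln (real n) + real m * real n)))"
  (is "?accuracy \<and> ?complexity")
proof
  show ?accuracy using approx_barycenter_accuracy by (simp add: is_arg_min_def)
  show ?complexity
  proof (intro allI impI)
    fix a :: real assume "0 < a"
    then show "\<exists>K :: real. \<forall>m n (w :: nat \<Rightarrow> real) (p :: nat \<Rightarrow> nat \<Rightarrow> real)
        (C :: nat \<Rightarrow> nat \<Rightarrow> nat \<Rightarrow> real) (\<epsilon> :: real) mul mulT (M :: nat \<Rightarrow> nat \<Rightarrow> real).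
      bary_instance m n w p C \<and> 0 < \<epsilon> \<and> \<epsilon> \<le> a * max_cost m n C
      \<and> kernel_routines m n C (reg_param n \<epsilon>) (mul (reg_param n \<epsilon>)) (mulT (reg_param n \<epsilon>))
      \<and> iteration_cost m n w p (mul (reg_param n \<epsilon>)) (mulT (reg_param n \<epsilon>)) (M m n) \<longrightarrow>
        (\<exists>q k. procedure_run m n w p C \<epsilon> mul mulT q k
             \<and> (\<forall>j<n. q j = approx_barycenter m n w p C \<epsilon> j)
             \<and> real k \<le> K * ((max_cost m n C / \<epsilon>)\<^sup>2 * M m n * ln (real n) + real m * real n))"
      \<comment> \<open>The constant depends on \<open>a\<close> alone, so it is fixed before the
        instance and the routines.\<close>
      by (intro exI[of _ "4096 + 8 * a\<^sup>2 / ln 2 + 9"] allI impI procedure_run_bound) auto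
  qed
qed

end
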